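(* Let $a_1,a_2,\dots$ be a sequence of positive numbers for which there are constants $c_1,c_2$ with $0<c_1\le a_i/a_j\le c_2<\infty$ for all $i,j$. For each $n$ let $E_n$ be the ellipsoid in $\mathbb{R}^n$ with major semi-axes $a_1,\dots,a_n$, and let $\mathcal{R}(E_n)=V_{n-1}(\partial E_n)/V_n(E_n)$. Then $$\lim_{n\to\infty}\frac{\Gamma\left(\frac{n+1}2\right)}{\Gamma\left(\frac n2\right)}\cdot\frac{\mathcal{R}(E_n)}{n\sqrt{\frac12\sum_{i=1}^n \frac1{a_i^2}}}=1.$$
   Context: $E_n=\{x\in\mathbb{R}^n : \sum_{i=1}^n x_i^2/a_i^2\le1\}$. $V_n(E_n)$ is the $n$-dimensional volume of $E_n$ and $V_{n-1}(\partial E_n)$ is the surface area of its boundary. *)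

theory Defs
  imports "HOL-Analysis.Analysis"
begin

text \<open>
  Since the dimension \<open>n\<close> varies inside the statement, \<open>n\<close>-space is modelled as the set of
  functions that are extensional on \<open>{1..n}\<close>.  It carries the product Lebesgue measure, the
  Euclidean distance and the product (equivalently, Euclidean) topology.
\<close>

definition Rn :: "nat \<Rightarrow> (nat \<Rightarrow> real) set" where
  "Rn n = {1..n} \<rightarrow>\<^sub>E UNIV"

definition dist_Rn :: "nat \<Rightarrow> (nat \<Rightarrow> real) \<Rightarrow> (nat \<Rightarrow> real) \<Rightarrow> real" where
  "dist_Rn n x y = L2_set (\<lambda>i. x i - y i) {1..n}"

definition volume :: "nat \<Rightarrow> (nat \<Rightarrow> real) set \<Rightarrow> real" where
  "volume n S = measure (\<Pi>\<^sub>M i\<in>{1..n}. lborel) S"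

definition boundary :: "nat \<Rightarrow> (nat \<Rightarrow> real) set \<Rightarrow> (nat \<Rightarrow> real) set" where
  "boundary n S = (powertop_real {1..n}) frontier_of S"

definition tube :: "nat \<Rightarrow> real \<Rightarrow> (nat \<Rightarrow> real) set \<Rightarrow> (nat \<Rightarrow> real) set" where
  "tube n \<epsilon> S = {x \<in> Rn n. \<exists>y\<in>S. dist_Rn n x y < \<epsilon>}"

text \<open>
  The \<open>(n-1)\<close>-dimensional volume (surface area) of a hypersurface \<open>S\<close> in \<open>n\<close>-space, in Minkowski's
  sense: the volume of the tube of radius \<open>\<epsilon>\<close> around \<open>S\<close> divided by its thickness \<open>2\<epsilon>\<close>, in the
  limit \<open>\<epsilon> \<rightarrow> 0\<close>.  The limit exists for compact smooth hypersurfaces, such as the boundary of an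
  ellipsoid, and is the usual surface area; if it does not exist, the value is unspecified.
\<close>

definition surface_area :: "nat \<Rightarrow> (nat \<Rightarrow> real) set \<Rightarrow> real" where
  "surface_area n S = Lim (at_right 0) (\<lambda>\<epsilon>. volume n (tube n \<epsilon> S) / (2 * \<epsilon>))"

definition ellipsoid :: "(nat \<Rightarrow> real) \<Rightarrow> nat \<Rightarrow> (nat \<Rightarrow> real) set" where
  "ellipsoid a n = {x \<in> Rn n. (\<Sum>i=1..n. (x i)\<^sup>2 / (a i)\<^sup>2) \<le> 1}"

definition surface_volume_ratio :: "nat \<Rightarrow> (nat \<Rightarrow> real) set \<Rightarrow> real" where
  "surface_volume_ratio n S = surface_area n (boundary n S) / volume n S"

end

theory Submission
  imports Defs "HOL-Probability.Distributions" "HOL-Real_Asymp.Real_Asymp"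
begin

text \<open>
  Write the ellipsoid as the unit ball of the norm \<open>f x = sqrt (\<Sum>i. (x i / a i)^2)\<close>, and let \<open>g\<close> be
  the length of the gradient of \<open>f\<close>. The function \<open>g\<close> is constant along rays. The proof has a
  geometric half, which expresses the surface area exactly as an integral of \<open>g\<close>, and a
  probabilistic half, which evaluates the integral asymptotically.

  Near the boundary \<open>f = 1\<close> the distance to it is \<open>\<bar>f - 1\<bar> / g\<close> up to a factor tending to \<open>1\<close>, by
  convexity of \<open>f\<close> (\<open>near_level_set\<close>) and by walking along the normal direction (\<open>level_set_near\<close>).
  Hence the tube of radius \<open>\<epsilon>\<close> is squeezed between shells \<open>1 - \<delta> g < f \<le> 1 + \<delta> g\<close> with \<open>\<delta> / \<epsilon>\<close>
  tending to \<open>1\<close>. Polar coordinates with respect to \<open>f\<close> (\<open>nn_integral_polar\<close>), which need only the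
  behaviour of Lebesgue measure under dilations, show that the set \<open>f \<le> 1 + s g\<close> has as its volume the
  integral of \<open>(1 + s g)^n\<close> over the ellipsoid (\<open>emeasure_star_shaped\<close>). Differentiating this
  polynomial at \<open>s = 0\<close>, the surface area is \<open>n\<close> times the integral of \<open>g\<close> over the ellipsoid
  (\<open>surface_area_ellipsoid\<close>), and the ratio of area to volume is \<open>n\<close> times the mean of \<open>g\<close>.

  Since \<open>g\<close> is constant along rays, its mean does not change when the uniform distribution on the
  ellipsoid is replaced by the Gaussian one with density proportional to \<open>exp (- f^2 / 2)\<close>
  (\<open>surface_volume_ratio_ellipsoid\<close>). Then \<open>x i = a i * Z i\<close> with independent standard normal \<open>Z i\<close>, and
  \<open>g^2\<close> is the weighted mean of the numbers \<open>1 / (a i)^2\<close> with weights \<open>(Z i)^2\<close>. Because the semi-axes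
  are comparable, no single index dominates, and by Chebyshev-type estimates \<open>g^2\<close> concentrates at
  the plain mean of these numbers (\<open>expected_slope\<close>). So the ratio of area to volume behaves like
  \<open>n * sqrt ((\<Sum>i. 1 / (a i)^2) / n)\<close>, and the quotient of Gamma values supplies the remaining factor
  \<open>sqrt (n / 2)\<close> (\<open>Gamma_half_step_asymptotic\<close>).
\<close>

section \<open>Lebesgue measure and dilations\<close>

definition dilate :: "nat \<Rightarrow> real \<Rightarrow> (nat \<Rightarrow> real) \<Rightarrow> (nat \<Rightarrow> real)" where
  "dilate n r x = (\<lambda>i\<in>{1..n}. r * x i)"

abbreviation lebesgue_Rn :: "nat \<Rightarrow> (nat \<Rightarrow> real) measure" where
  "lebesgue_Rn n \<equiv> \<Pi>\<^sub>M i\<in>{1..n}. lborel"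

interpretation lborel_product: product_sigma_finite "\<lambda>_::nat. lborel :: real measure"
  by standard

lemma space_lebesgue_Rn [simp]: "space (lebesgue_Rn n) = Rn n"
  by (simp add: space_PiM Rn_def)

lemma sigma_finite_lebesgue_Rn: "sigma_finite_measure (lebesgue_Rn n)"
  by (intro lborel_product.sigma_finite) simp

lemma dilate_in_Rn [simp]: "dilate n r x \<in> Rn n"
  by (simp add: dilate_def Rn_def)

lemma dilate_one [simp]: "x \<in> Rn n \<Longrightarrow> dilate n 1 x = x"
  by (auto simp: dilate_def Rn_def PiE_def extensional_def fun_eq_iff)

lemma measurable_dilate [measurable]:
  assumes [measurable]: "r \<in> borel_measurable M" "g \<in> measurable M (lebesgue_Rn n)"
  shows "(\<lambda>z. dilate n (r z) (g z)) \<in> measurable M (lebesgue_Rn n)"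
proof -
  have "(\<lambda>z. g z i) \<in> borel_measurable M" if "i \<in> {1..n}" for i
    using measurable_compose[OF assms(2) measurable_component_singleton[OF that]] by simp
  then show ?thesis
    unfolding dilate_def by (intro measurable_restrict) auto
qed

lemma nn_integral_PiM_dilate:
  fixes I :: "nat set"
  assumes "finite I" "r > 0" "f \<in> borel_measurable (PiM I (\<lambda>_. lborel))"
  shows "(\<integral>\<^sup>+x. f x \<partial>PiM I (\<lambda>_. lborel :: real measure)) =
         ennreal (r ^ card I) * (\<integral>\<^sup>+x. f (\<lambda>i\<in>I. r * x i) \<partial>PiM I (\<lambda>_. lborel))"
  using assms
proof (induction I arbitrary: f)
  case empty
  then show ?case
    by (simp add: PiM_empty nn_integral_count_space_finite restrict_def)
next
  case (insert i I f)
  note [measurable] = insert.prems(2)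
  let ?P = "\<lambda>I. PiM I (\<lambda>_. lborel :: real measure)"
  have sf: "sigma_finite_measure (lborel :: real measure)" ..
  have upd: "(\<lambda>j\<in>insert i I. r * (x(i := y)) j) = (\<lambda>j\<in>I. r * x j)(i := r * y)" for x :: "nat \<Rightarrow> real" and y
    using insert.hyps by (auto simp: fun_eq_iff restrict_def)
  have m1: "(\<lambda>z. f ((fst z)(i := r * snd z))) \<in> borel_measurable (?P I \<Otimes>\<^sub>M lborel)"
    by measurable
  have m2: "(\<lambda>x. \<integral>\<^sup>+y. f (x(i := r * y)) \<partial>lborel) \<in> borel_measurable (?P I)"
    using sigma_finite_measure.borel_measurable_nn_integral[OF sf, of "\<lambda>x y. f (x(i := r * y))" "?P I"] m1
    by (simp add: case_prod_unfold)
  have "(\<integral>\<^sup>+x. f x \<partial>?P (insert i I)) = (\<integral>\<^sup>+x. \<integral>\<^sup>+y. f (x(i := y)) \<partial>lborel \<partial>?P I)"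
    using insert by (intro lborel_product.product_nn_integral_insert) auto
  also have "\<dots> = (\<integral>\<^sup>+x. ennreal r * (\<integral>\<^sup>+y. f (x(i := r * y)) \<partial>lborel) \<partial>?P I)"
  proof (intro nn_integral_cong)
    fix x assume x: "x \<in> space (?P I)"
    have "(\<lambda>y. f (x(i := y))) \<in> borel_measurable borel"
      using x by measurable
    from nn_integral_real_affine[OF this, of r 0]
    show "(\<integral>\<^sup>+y. f (x(i := y)) \<partial>lborel) = ennreal r * (\<integral>\<^sup>+y. f (x(i := r * y)) \<partial>lborel)"
      using \<open>r > 0\<close> by simp
  qed
  also have "\<dots> = ennreal r * (\<integral>\<^sup>+x. (\<integral>\<^sup>+y. f (x(i := r * y)) \<partial>lborel) \<partial>?P I)"
    by (intro nn_integral_cmult m2)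
  also have "\<dots> = ennreal r * (ennreal (r ^ card I) *
                   (\<integral>\<^sup>+x. (\<integral>\<^sup>+y. f ((\<lambda>j\<in>I. r * x j)(i := r * y)) \<partial>lborel) \<partial>?P I))"
    using insert.IH[OF \<open>r > 0\<close> m2] by (simp only:)
  also have "\<dots> = ennreal (r ^ card (insert i I)) *
                   (\<integral>\<^sup>+x. (\<integral>\<^sup>+y. f (\<lambda>j\<in>insert i I. r * (x(i := y)) j) \<partial>lborel) \<partial>?P I)"
    unfolding upd using insert.hyps \<open>r > 0\<close> by (simp add: ennreal_mult mult.assoc)
  also have "(\<integral>\<^sup>+x. (\<integral>\<^sup>+y. f (\<lambda>j\<in>insert i I. r * (x(i := y)) j) \<partial>lborel) \<partial>?P I) =
             (\<integral>\<^sup>+x. f (\<lambda>j\<in>insert i I. r * x j) \<partial>?P (insert i I))"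
    using insert.hyps by (intro lborel_product.product_nn_integral_insert [symmetric]) auto
  finally show ?case .
qed

lemma nn_integral_dilate:
  assumes "r > 0" "f \<in> borel_measurable (lebesgue_Rn n)"
  shows "(\<integral>\<^sup>+x. f x \<partial>lebesgue_Rn n) = ennreal (r ^ n) * (\<integral>\<^sup>+x. f (dilate n r x) \<partial>lebesgue_Rn n)"
  using nn_integral_PiM_dilate[of "{1..n}" r f] assms by (simp add: dilate_def)

section \<open>Polar coordinates with respect to a homogeneous function\<close>

lemma ennreal_mult3:
  assumes "0 \<le> a" "0 \<le> b" "0 \<le> c"
  shows "ennreal a * (ennreal b * ennreal c) = ennreal (a * (b * c))"
  using assms by (simp add: ennreal_mult)

lemma nn_integral_inverse_power_atLeast:
  assumes "n \<ge> 1" "c > 0"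
  shows "(\<integral>\<^sup>+s. ennreal (real n * (1 / s) ^ (n + 1)) * indicator {c..} s \<partial>lborel) = ennreal ((1 / c) ^ n)"
proof -
  have "(\<integral>\<^sup>+s. ennreal (real n * (1 / s) ^ (n + 1)) * indicator {c..} s \<partial>lborel) =
        ennreal (0 - (- ((1 / c) ^ n)))"
  proof (rule nn_integral_FTC_atLeast)
    show "((\<lambda>s. - ((1 / s) ^ n)) has_real_derivative real n * (1 / x) ^ (n + 1)) (at x)" if "c \<le> x" for x :: real
    proof -
      have "((\<lambda>s. 1 / s) has_real_derivative - ((1 / x) ^ 2)) (at x)"
        using that assms by (auto intro!: derivative_eq_intros simp: power2_eq_square)
      from DERIV_minus[OF DERIV_power[OF this, of n]] show ?thesis
        using assms by (cases n) (auto simp: power2_eq_square mult_ac)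
    qed
    have "((\<lambda>s::real. - ((1 / s) ^ n)) \<longlongrightarrow> - (0 ^ n)) at_top"
      by (intro tendsto_intros) (rule tendsto_divide_0[OF tendsto_const filterlim_at_top_imp_at_infinity[OF filterlim_ident]])
    then show "((\<lambda>s::real. - ((1 / s) ^ n)) \<longlongrightarrow> 0) at_top"
      using assms by (simp add: power_0_left)
  qed (use assms in auto)
  then show ?thesis by simp
qed

lemma nn_integral_power_Icc:
  assumes "n \<ge> 1" "c \<ge> 0"
  shows "(\<integral>\<^sup>+r. ennreal (real n * r ^ (n - 1)) * indicator {0..c} r \<partial>lborel) = ennreal (c ^ n)"
proof -
  have "(\<integral>\<^sup>+r. ennreal (real n * r ^ (n - 1)) * indicator {0..c} r \<partial>lborel) = ennreal (c ^ n - 0 ^ n)"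
  proof (rule nn_integral_FTC_Icc)
    show "((\<lambda>r. r ^ n) has_real_derivative real n * x ^ (n - 1)) (at x)" for x :: real
      by (auto intro!: derivative_eq_intros)
  qed (use assms in auto)
  with assms show ?thesis by (simp add: power_0_left)
qed

text \<open>
  Polar coordinates with respect to a positively homogeneous function \<open>N\<close>, with the region
  \<open>0 < N \<le> 1\<close> playing the role of the unit sphere, so that no surface measure is needed.
  On the right-hand side put \<open>r = s * N x\<close>, exchange the integrals and undo the dilation by \<open>s\<close>.
  What then multiplies \<open>F x\<close> is \<open>N x ^ n\<close> times the integral of \<open>n / s ^ (n + 1)\<close> over
  \<open>s \<ge> N x\<close>, and this is \<open>1\<close>.
\<close>

lemma nn_integral_polar:
  assumes n: "n \<ge> 1"
    and [measurable]: "N \<in> borel_measurable (lebesgue_Rn n)" "F \<in> borel_measurable (lebesgue_Rn n)"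
    and hom: "\<And>x r. x \<in> Rn n \<Longrightarrow> r > 0 \<Longrightarrow> N (dilate n r x) = r * N x"
  shows "(\<integral>\<^sup>+x. F x * indicator {x. 0 < N x} x \<partial>lebesgue_Rn n) =
         (\<integral>\<^sup>+x. (\<integral>\<^sup>+r. ennreal (real n * r ^ (n - 1)) * F (dilate n (r / N x) x) * indicator {0<..} r \<partial>lborel)
               * indicator {x. 0 < N x \<and> N x \<le> (1::real)} x \<partial>lebesgue_Rn n)"
proof -
  interpret P: pair_sigma_finite "lebesgue_Rn n" "lborel :: real measure"
    by (intro pair_sigma_finite.intro sigma_finite_lebesgue_Rn) standard
  \<comment> \<open>\<open>H\<close> is the integrand on the right after \<open>r = s * N x\<close>, and \<open>J\<close> is \<open>H\<close> with the dilation by \<open>s\<close> undone.\<close>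
  define H where "H = (\<lambda>x s. ennreal (real n * s ^ (n - 1)) * ennreal (N x ^ n) * F (dilate n s x)
      * indicator {0<..} s * indicator {x. 0 < N x \<and> N x \<le> 1} x)"
  define K where "K = (\<lambda>s::real. ennreal (real n * (1 / s) ^ (n + 1)) * indicator {0<..} s)"
  define J where "J = (\<lambda>x s. F x * ennreal (N x ^ n) * K s * indicator {x. 0 < N x \<and> N x \<le> s} x)"
  have [measurable]: "K \<in> borel_measurable borel" unfolding K_def by measurable
  have [measurable]: "case_prod J \<in> borel_measurable (lebesgue_Rn n \<Otimes>\<^sub>M lborel)"
    unfolding J_def by measurable
  have H [measurable]: "case_prod H \<in> borel_measurable (lebesgue_Rn n \<Otimes>\<^sub>M lborel)"
    unfolding H_def by measurable
  have "(\<integral>\<^sup>+x. (\<integral>\<^sup>+r. ennreal (real n * r ^ (n - 1)) * F (dilate n (r / N x) x) * indicator {0<..} r \<partial>lborel)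
               * indicator {x. 0 < N x \<and> N x \<le> 1} x \<partial>lebesgue_Rn n) = (\<integral>\<^sup>+x. \<integral>\<^sup>+s. H x s \<partial>lborel \<partial>lebesgue_Rn n)"
  proof (intro nn_integral_cong)
    fix x assume x[measurable]: "x \<in> space (lebesgue_Rn n)"
    show "(\<integral>\<^sup>+r. ennreal (real n * r ^ (n - 1)) * F (dilate n (r / N x) x) * indicator {0<..} r \<partial>lborel)
               * indicator {x. 0 < N x \<and> N x \<le> 1} x = (\<integral>\<^sup>+s. H x s \<partial>lborel)"
    proof (cases "0 < N x \<and> N x \<le> 1")
      case True
      define c where "c = N x"
      have c: "c > 0" using True by (simp add: c_def)
      have m: "(\<lambda>r. ennreal (real n * r ^ (n - 1)) * F (dilate n (r / N x) x) * indicator {0<..} r) \<in> borel_measurable borel"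
        by measurable
      have "(\<integral>\<^sup>+r. ennreal (real n * r ^ (n - 1)) * F (dilate n (r / N x) x) * indicator {0<..} r \<partial>lborel) =
        ennreal c * (\<integral>\<^sup>+s. ennreal (real n * (c * s) ^ (n - 1)) * F (dilate n (c * s / N x) x) * indicator {0<..} (c * s) \<partial>lborel)"
        using nn_integral_real_affine[OF m, of c 0] c by simp
      also have "\<dots> = (\<integral>\<^sup>+s. ennreal c * (ennreal (real n * (c * s) ^ (n - 1)) * F (dilate n (c * s / N x) x) * indicator {0<..} (c * s)) \<partial>lborel)"
        by (intro nn_integral_cmult [symmetric]) measurable
      also have "\<dots> = (\<integral>\<^sup>+s. H x s \<partial>lborel)"
      proof (intro nn_integral_cong)
        fix s :: real
        have cn: "c * c ^ (n - 1) = c ^ n" using n by (cases n) auto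
        show "ennreal c * (ennreal (real n * (c * s) ^ (n - 1)) * F (dilate n (c * s / N x) x) * indicator {0<..} (c * s)) = H x s"
        proof (cases "s > 0")
          case s: True
          have "ennreal c * ennreal (real n * (c * s) ^ (n - 1)) = ennreal (c * (real n * (c * s) ^ (n - 1)))"
            using c s by (intro ennreal_mult [symmetric]) auto
          also have "c * (real n * (c * s) ^ (n - 1)) = (real n * s ^ (n - 1)) * c ^ n"
            unfolding cn[symmetric] by (simp add: power_mult_distrib)
          also have "ennreal \<dots> = ennreal (real n * s ^ (n - 1)) * ennreal (c ^ n)"
            using c s by (intro ennreal_mult) auto
          finally show ?thesis using s c True
            by (simp add: H_def c_def mult.assoc[symmetric])
        qed (use c in \<open>auto simp: H_def zero_less_mult_iff\<close>)
      qed
      finally show ?thesis using True by simp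
    qed (auto simp: H_def)
  qed
  also have "\<dots> = (\<integral>\<^sup>+s. \<integral>\<^sup>+x. H x s \<partial>lebesgue_Rn n \<partial>lborel)"
    by (rule P.Fubini' [symmetric]) measurable
  also have "\<dots> = (\<integral>\<^sup>+s. \<integral>\<^sup>+x. J x s \<partial>lebesgue_Rn n \<partial>lborel)"
  proof (rule nn_integral_cong)
    fix s :: real
    show "(\<integral>\<^sup>+x. H x s \<partial>lebesgue_Rn n) = (\<integral>\<^sup>+x. J x s \<partial>lebesgue_Rn n)"
    proof (cases "s > 0")
      case s: True
      have Js [measurable]: "(\<lambda>x. J x s) \<in> borel_measurable (lebesgue_Rn n)"
        unfolding J_def by measurable
      have "(\<integral>\<^sup>+x. J x s \<partial>lebesgue_Rn n) = ennreal (s ^ n) * (\<integral>\<^sup>+x. J (dilate n s x) s \<partial>lebesgue_Rn n)"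
        using nn_integral_dilate[OF s Js] .
      also have "\<dots> = (\<integral>\<^sup>+x. ennreal (s ^ n) * J (dilate n s x) s \<partial>lebesgue_Rn n)"
        by (intro nn_integral_cmult [symmetric] measurable_compose[OF measurable_dilate Js]) auto
      also have "\<dots> = (\<integral>\<^sup>+x. H x s \<partial>lebesgue_Rn n)"
      proof (intro nn_integral_cong)
        fix x assume "x \<in> space (lebesgue_Rn n)"
        then have Ns: "N (dilate n s x) = s * N x" using hom[OF _ s, of x] by (simp only: space_lebesgue_Rn)
        have sn: "s ^ n * (s ^ n * (1 / s) ^ (n + 1)) = s ^ (n - 1)"
          using n s by (cases n) (auto simp: field_simps)
        show "ennreal (s ^ n) * J (dilate n s x) s = H x s"
        proof (cases "0 < N x \<and> N x \<le> 1")
          case True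
          have "ennreal (s ^ n) * (ennreal ((s * N x) ^ n) * ennreal (real n * (1 / s) ^ (n + 1))) =
                ennreal (s ^ n * ((s * N x) ^ n * (real n * (1 / s) ^ (n + 1))))"
            using s True by (intro ennreal_mult3) auto
          also have "s ^ n * ((s * N x) ^ n * (real n * (1 / s) ^ (n + 1))) = real n * s ^ (n - 1) * N x ^ n"
            unfolding sn[symmetric] by (simp add: power_mult_distrib)
          also have "ennreal \<dots> = ennreal (real n * s ^ (n - 1)) * ennreal (N x ^ n)"
            using s True by (intro ennreal_mult) auto
          finally have "ennreal (s ^ n) * (ennreal ((s * N x) ^ n) * ennreal (real n * (1 / s) ^ (n + 1))) * F (dilate n s x)
              = ennreal (real n * s ^ (n - 1)) * ennreal (N x ^ n) * F (dilate n s x)" by simp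
          then show ?thesis using s True by (simp add: H_def J_def K_def Ns mult_ac mult_le_cancel_left1)
        next
          case False
          with s show ?thesis by (auto simp: H_def J_def K_def Ns indicator_def zero_less_mult_iff)
        qed
      qed
      finally show ?thesis by simp
    qed (auto simp: H_def J_def K_def)
  qed
  also have "\<dots> = (\<integral>\<^sup>+x. \<integral>\<^sup>+s. J x s \<partial>lborel \<partial>lebesgue_Rn n)"
    by (rule P.Fubini') measurable
  also have "\<dots> = (\<integral>\<^sup>+x. F x * indicator {x. 0 < N x} x \<partial>lebesgue_Rn n)"
  proof (intro nn_integral_cong)
    fix x assume "x \<in> space (lebesgue_Rn n)"
    show "(\<integral>\<^sup>+s. J x s \<partial>lborel) = F x * indicator {x. 0 < N x} x"
    proof (cases "N x > 0")
      case True
      have "(\<integral>\<^sup>+s. J x s \<partial>lborel) =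
            (\<integral>\<^sup>+s. (F x * ennreal (N x ^ n)) * (ennreal (real n * (1 / s) ^ (n + 1)) * indicator {N x..} s) \<partial>lborel)"
        using True by (intro nn_integral_cong) (auto simp: J_def K_def indicator_def mult.assoc)
      also have "\<dots> = F x * ennreal (N x ^ n) * ennreal ((1 / N x) ^ n)"
        using nn_integral_inverse_power_atLeast[OF n True] by (subst nn_integral_cmult) auto
      also have "\<dots> = F x * ennreal (N x ^ n * (1 / N x) ^ n)"
        using True by (simp add: ennreal_mult mult.assoc)
      also have "N x ^ n * (1 / N x) ^ n = 1"
        using True by (simp add: field_simps)
      finally show ?thesis using True by simp
    qed (simp add: J_def)
  qed
  finally show ?thesis by simp
qed

section \<open>The norm of an ellipsoid and distances to its boundary\<close>

lemma L2_set_abs_mono: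
  assumes "\<And>i. i \<in> K \<Longrightarrow> \<bar>f i\<bar> \<le> \<bar>g i\<bar>"
  shows "L2_set f K \<le> L2_set g K"
  unfolding L2_set_def using assms
  by (intro real_sqrt_le_mono sum_mono) (simp add: abs_le_square_iff)

lemma L2_set_scale: "L2_set (\<lambda>i. r * f i) K = \<bar>r\<bar> * L2_set f K"
  unfolding L2_set_def
  by (simp add: power_mult_distrib sum_distrib_left[symmetric] real_sqrt_mult)

lemma power2_L2_set: "(L2_set f K)\<^sup>2 = (\<Sum>i\<in>K. (f i)\<^sup>2)"
  unfolding L2_set_def by (simp add: sum_nonneg)

lemma sum_mult_le_L2_set: "(\<Sum>i\<in>K. f i * g i) \<le> L2_set f K * L2_set g K"
proof -
  have "(\<Sum>i\<in>K. f i * g i) \<le> (\<Sum>i\<in>K. \<bar>f i\<bar> * \<bar>g i\<bar>)"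
    by (intro sum_mono) (simp flip: abs_mult)
  also have "\<dots> \<le> L2_set f K * L2_set g K"
    by (rule L2_set_mult_ineq)
  finally show ?thesis .
qed

text \<open>
  The geometry of one fixed ellipsoid: \<open>ell_norm\<close> is the norm whose unit ball is the ellipsoid.
  The vector with the coordinates \<open>x i / (a i)^2\<close> is normal at \<open>x\<close> to the level set of \<open>ell_norm\<close>
  through \<open>x\<close>; \<open>ell_normal\<close> is its length, and \<open>slope\<close> is the length of the gradient of
  \<open>ell_norm\<close>.
\<close>

locale semiaxes =
  fixes n :: nat and a :: "nat \<Rightarrow> real"
  assumes n_pos: "n \<ge> 1" and pos: "\<And>i. i \<in> {1..n} \<Longrightarrow> a i > 0"
begin

definition ell_norm :: "(nat \<Rightarrow> real) \<Rightarrow> real" where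
  "ell_norm x = L2_set (\<lambda>i. x i / a i) {1..n}"

definition ell_normal :: "(nat \<Rightarrow> real) \<Rightarrow> real" where
  "ell_normal x = L2_set (\<lambda>i. x i / (a i)\<^sup>2) {1..n}"

definition slope :: "(nat \<Rightarrow> real) \<Rightarrow> real" where
  "slope x = ell_normal x / ell_norm x"

text \<open>
  Cheap bounds for \<open>1 / a i\<close> from above and below; sums are easier to handle than the exact
  maximum and minimum.
\<close>

definition kmax :: real where "kmax = (\<Sum>i=1..n. 1 / a i)"
definition kmin :: real where "kmin = 1 / (\<Sum>i=1..n. a i)"

lemma ell_norm_nonneg [simp]: "ell_norm x \<ge> 0" and ell_normal_nonneg [simp]: "ell_normal x \<ge> 0"
  by (simp_all add: ell_norm_def ell_normal_def)

lemma slope_nonneg [simp]: "slope x \<ge> 0"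
  by (simp add: slope_def)

lemma power2_ell_norm: "(ell_norm x)\<^sup>2 = (\<Sum>i=1..n. (x i)\<^sup>2 / (a i)\<^sup>2)"
  unfolding ell_norm_def power2_L2_set by (simp add: power_divide)

lemma ell_norm_le_1_iff: "ell_norm x \<le> 1 \<longleftrightarrow> (\<Sum>i=1..n. (x i)\<^sup>2 / (a i)\<^sup>2) \<le> 1"
  unfolding power2_ell_norm[symmetric] by (simp add: power_le_one_iff abs_le_square_iff[of _ 1, simplified])

lemma ellipsoid_eq: "ellipsoid a n = {x \<in> Rn n. ell_norm x \<le> 1}"
  by (simp add: ellipsoid_def ell_norm_le_1_iff)

lemma ell_norm_dilate: "ell_norm (dilate n r x) = \<bar>r\<bar> * ell_norm x"
  unfolding ell_norm_def L2_set_scale[symmetric] by (intro L2_set_cong) (auto simp: dilate_def)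

lemma ell_normal_dilate: "ell_normal (dilate n r x) = \<bar>r\<bar> * ell_normal x"
  unfolding ell_normal_def L2_set_scale[symmetric] by (intro L2_set_cong) (auto simp: dilate_def)

lemma slope_dilate: "r > 0 \<Longrightarrow> slope (dilate n r x) = slope x"
  by (simp add: slope_def ell_norm_dilate ell_normal_dilate)

lemma ell_norm_eq_0_iff: "ell_norm x = 0 \<longleftrightarrow> (\<forall>i\<in>{1..n}. x i = 0)"
  unfolding ell_norm_def using pos by (fastforce simp: L2_set_eq_0_iff)

lemma kmax: "i \<in> {1..n} \<Longrightarrow> 1 / a i \<le> kmax"
  unfolding kmax_def using pos by (intro member_le_sum) (auto intro: less_imp_le)

lemma kmin: "i \<in> {1..n} \<Longrightarrow> kmin \<le> 1 / a i"
  unfolding kmin_def using pos by (intro divide_left_mono member_le_sum mult_pos_pos sum_pos2[of _ i])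
     (auto intro: less_imp_le)

lemma kmin_pos: "kmin > 0"
  unfolding kmin_def using pos n_pos by (auto intro!: sum_pos)

lemma kmax_pos: "kmax > 0"
  unfolding kmax_def using pos n_pos by (auto intro!: sum_pos)

lemma divide_le_kmax:
  assumes "i \<in> {1..n}" shows "\<bar>t / a i\<bar> \<le> kmax * \<bar>t\<bar>"
  using mult_right_mono[OF kmax[OF assms], of "\<bar>t\<bar>"] pos[OF assms] by (simp add: field_simps)

lemma ell_norm_le: "ell_norm x \<le> kmax * L2_set x {1..n}"
proof -
  have "ell_norm x \<le> L2_set (\<lambda>i. kmax * x i) {1..n}"
    unfolding ell_norm_def using divide_le_kmax kmax_pos by (intro L2_set_abs_mono) (simp add: abs_mult)
  then show ?thesis using kmax_pos by (simp add: L2_set_scale)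
qed

lemma ell_normal_le: "ell_normal x \<le> kmax * ell_norm x"
proof -
  have "ell_normal x \<le> L2_set (\<lambda>i. kmax * (x i / a i)) {1..n}"
    unfolding ell_normal_def
  proof (intro L2_set_abs_mono)
    fix i assume "i \<in> {1..n}"
    from divide_le_kmax[OF this, of "x i / a i"] show "\<bar>x i / (a i)\<^sup>2\<bar> \<le> \<bar>kmax * (x i / a i)\<bar>"
      using kmax_pos by (simp add: abs_mult power2_eq_square)
  qed
  then show ?thesis using kmax_pos unfolding L2_set_scale ell_norm_def by simp
qed

lemma ell_normal_ge: "kmin * ell_norm x \<le> ell_normal x"
proof -
  have "L2_set (\<lambda>i. kmin * (x i / a i)) {1..n} \<le> ell_normal x"
    unfolding ell_normal_def
  proof (intro L2_set_abs_mono)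
    fix i assume i: "i \<in> {1..n}"
    have "kmin * \<bar>x i / a i\<bar> \<le> 1 / a i * \<bar>x i / a i\<bar>"
      by (intro mult_right_mono kmin[OF i]) auto
    then show "\<bar>kmin * (x i / a i)\<bar> \<le> \<bar>x i / (a i)\<^sup>2\<bar>"
      using kmin_pos pos[OF i] by (simp add: abs_mult power2_eq_square)
  qed
  then show ?thesis using kmin_pos unfolding L2_set_scale ell_norm_def by simp
qed

lemma slope_le: "slope x \<le> kmax"
  using ell_normal_le[of x] kmax_pos ell_norm_nonneg[of x] unfolding slope_def
  by (cases "ell_norm x = 0") (auto simp: divide_le_eq less_le)

lemma slope_ge: "ell_norm x > 0 \<Longrightarrow> kmin \<le> slope x"
  using ell_normal_ge[of x] by (simp add: slope_def le_divide_eq)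

lemma L2_set_diff_commute: "L2_set (\<lambda>i. x i - y i) K = L2_set (\<lambda>i. y i - x i) K"
  by (simp add: L2_set_def power2_commute)

lemma ell_norm_lipschitz: "ell_norm x - ell_norm y \<le> kmax * dist_Rn n x y"
proof -
  have "ell_norm x \<le> ell_norm y + ell_norm (\<lambda>i. x i - y i)"
    unfolding ell_norm_def
    using L2_set_triangle_ineq[of "\<lambda>i. y i / a i" "\<lambda>i. (x i - y i) / a i" "{1..n}"]
    by (simp add: diff_divide_distrib)
  with ell_norm_le[of "\<lambda>i. x i - y i"] show ?thesis by (simp add: dist_Rn_def)
qed

lemma ell_normal_lipschitz: "ell_normal x - ell_normal y \<le> kmax\<^sup>2 * dist_Rn n x y"
proof -
  have "ell_normal x \<le> ell_normal y + ell_normal (\<lambda>i. x i - y i)"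
    unfolding ell_normal_def
    using L2_set_triangle_ineq[of "\<lambda>i. y i / (a i)\<^sup>2" "\<lambda>i. (x i - y i) / (a i)\<^sup>2" "{1..n}"]
    by (simp add: diff_divide_distrib)
  also have "ell_normal (\<lambda>i. x i - y i) \<le> kmax * ell_norm (\<lambda>i. x i - y i)"
    by (rule ell_normal_le)
  also have "\<dots> \<le> kmax * (kmax * dist_Rn n x y)"
    using ell_norm_le[of "\<lambda>i. x i - y i"] kmax_pos by (intro mult_left_mono) (auto simp: dist_Rn_def)
  finally show ?thesis by (simp add: power2_eq_square mult.assoc)
qed

text \<open>
  Convexity of \<open>ell_norm\<close>, multiplied by \<open>ell_norm x\<close> so that it also makes sense at the origin.
  It amounts to the Cauchy-Schwarz inequality.
\<close>

lemma ell_norm_subgradient: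
  "(\<Sum>i=1..n. x i / (a i)\<^sup>2 * (y i - x i)) \<le> ell_norm x * (ell_norm y - ell_norm x)"
proof -
  have "(\<Sum>i=1..n. x i / (a i)\<^sup>2 * (y i - x i)) = (\<Sum>i=1..n. x i / a i * (y i / a i)) - (ell_norm x)\<^sup>2"
    unfolding power2_ell_norm sum_subtractf[symmetric]
    by (intro sum.cong) (auto simp: power2_eq_square algebra_simps diff_divide_distrib)
  also have "\<dots> \<le> ell_norm x * ell_norm y - (ell_norm x)\<^sup>2"
    unfolding ell_norm_def by (intro diff_right_mono sum_mult_le_L2_set)
  finally show ?thesis by (simp add: power2_eq_square algebra_simps)
qed

lemma ell_norm_diff_le:
  assumes "ell_norm x > 0"
  shows "ell_norm x - ell_norm y \<le> slope x * dist_Rn n x y"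
proof -
  have "ell_norm x * (ell_norm x - ell_norm y) \<le> - (\<Sum>i=1..n. x i / (a i)\<^sup>2 * (y i - x i))"
    using ell_norm_subgradient[of x y] by (simp add: algebra_simps)
  also have "\<dots> = (\<Sum>i=1..n. x i / (a i)\<^sup>2 * (x i - y i))"
    unfolding sum_negf[symmetric] by (intro sum.cong) (auto simp: algebra_simps diff_divide_distrib)
  also have "\<dots> \<le> ell_normal x * dist_Rn n x y"
    unfolding ell_normal_def dist_Rn_def by (rule sum_mult_le_L2_set)
  finally show ?thesis
    using assms by (simp add: slope_def field_simps)
qed

text \<open>
  The outer half of the comparison between tube and shell. Convexity applied at \<open>x\<close> gives the
  upper bound without any error. Applied at \<open>y\<close> it gives the lower bound with \<open>slope y\<close> in place of
  \<open>slope x\<close>, and the factor \<open>\<kappa>\<close> pays for the difference.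
\<close>

lemma near_level_set:
  assumes y: "ell_norm y = 1" and xy: "dist_Rn n x y < \<epsilon>" and \<epsilon>: "kmax * \<epsilon> \<le> 1 / 2"
  defines "\<kappa> \<equiv> 1 + (kmax + kmax\<^sup>2 / kmin) * \<epsilon>"
  shows "1 - \<kappa> * \<epsilon> * slope x < ell_norm x" and "ell_norm x \<le> 1 + \<kappa> * \<epsilon> * slope x"
proof -
  have d0: "dist_Rn n x y \<ge> 0" by (simp add: dist_Rn_def)
  with xy have \<epsilon>0: "\<epsilon> > 0" by simp
  have yx: "dist_Rn n y x = dist_Rn n x y"
    unfolding dist_Rn_def by (rule L2_set_diff_commute)
  have kd: "kmax * dist_Rn n x y \<le> kmax * \<epsilon>"
    using xy kmax_pos by (intro mult_left_mono) auto
  have gx: "ell_norm x \<ge> 1 / 2" "ell_norm x \<le> 1 + kmax * \<epsilon>"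
    using ell_norm_lipschitz[of y x] ell_norm_lipschitz[of x y] y \<epsilon> kd by (simp_all add: yx)
  have s: "slope x \<ge> kmin" using gx by (intro slope_ge) auto
  have s0: "slope x > 0" using s kmin_pos by linarith
  have \<kappa>1: "\<kappa> \<ge> 1" unfolding \<kappa>_def using kmax_pos kmin_pos \<epsilon>0 by (simp add: add_nonneg_nonneg)
  have "ell_norm x \<le> 1 + slope x * dist_Rn n x y"
    using ell_norm_diff_le[of x y] gx y by simp
  also have "slope x * dist_Rn n x y \<le> slope x * \<epsilon>"
    using xy by (intro mult_left_mono) auto
  also have "\<dots> \<le> slope x * (\<kappa> * \<epsilon>)"
    using \<kappa>1 \<epsilon>0 s0 by (intro mult_left_mono) auto
  finally show "ell_norm x \<le> 1 + \<kappa> * \<epsilon> * slope x" by (simp add: mult_ac)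
  have sy: "slope y = ell_normal y" using y by (simp add: slope_def)
  have sy0: "slope y > 0" using slope_ge[of y] kmin_pos y by simp
  have "kmax\<^sup>2 * dist_Rn n x y \<le> kmax\<^sup>2 * \<epsilon>"
    using xy by (intro mult_left_mono) auto
  also have "\<dots> = (kmax\<^sup>2 / kmin * \<epsilon>) * kmin" using kmin_pos by simp
  also have "\<dots> \<le> (kmax\<^sup>2 / kmin * \<epsilon>) * slope x"
    using kmin_pos \<epsilon>0 s by (intro mult_left_mono) auto
  finally have "ell_normal y \<le> ell_normal x + (kmax\<^sup>2 / kmin * \<epsilon>) * slope x"
    using ell_normal_lipschitz[of y x] by (simp add: yx)
  also have "ell_normal x = ell_norm x * slope x"
    using gx by (simp add: slope_def)
  also have "ell_norm x * slope x \<le> (1 + kmax * \<epsilon>) * slope x"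
    using gx s0 by (intro mult_right_mono) auto
  finally have ny: "ell_normal y \<le> \<kappa> * slope x"
    by (simp add: \<kappa>_def algebra_simps)
  have "1 - ell_norm x \<le> slope y * dist_Rn n x y"
    using ell_norm_diff_le[of y x] y by (simp add: yx)
  also have "\<dots> < slope y * \<epsilon>"
    using xy sy0 by simp
  also have "\<dots> \<le> \<kappa> * slope x * \<epsilon>"
    unfolding sy using ny \<epsilon>0 by (intro mult_right_mono) auto
  finally show "1 - \<kappa> * \<epsilon> * slope x < ell_norm x" by (simp add: mult_ac)
qed

text \<open>
  The inner half: a point of a slightly thinner shell reaches the level set in distance less than
  \<open>\<epsilon>\<close> by moving along the normal vector, by the intermediate value theorem. Outward, convexity
  says that the norm grows at least at the rate given by the slope. Inward, the norm may fall more
  slowly along the way, because the normal direction at \<open>x\<close> is not that at later points. One factor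
  \<open>1 - \<theta>\<close> accounts for this loss and the other one makes the distance strictly less than \<open>\<epsilon>\<close>.
\<close>

lemma level_set_near:
  assumes x: "1 - (1 - \<theta>)\<^sup>2 * \<epsilon> * slope x < ell_norm x" "ell_norm x \<le> 1 + (1 - \<theta>)\<^sup>2 * \<epsilon> * slope x"
    and \<theta>: "0 < \<theta>" "\<theta> < 1" and \<epsilon>: "0 < \<epsilon>" "kmax * \<epsilon> \<le> 1 / 2" "kmax\<^sup>2 * \<epsilon> \<le> kmin * \<theta>"
  shows "\<exists>y\<in>Rn n. ell_norm y = 1 \<and> dist_Rn n x y < \<epsilon>"
proof -
  define path where "path = (\<lambda>s. \<lambda>i\<in>{1..n}. x i + s * (x i / (a i)\<^sup>2))"
  have path_Rn: "path s \<in> Rn n" for s by (auto simp: path_def Rn_def)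
  have path_i: "path s i = x i + s * (x i / (a i)\<^sup>2)" if "i \<in> {1..n}" for s i
    using that by (simp add: path_def)
  have dist_path: "dist_Rn n x (path s) = \<bar>s\<bar> * ell_normal x" for s
  proof -
    have "dist_Rn n x (path s) = L2_set (\<lambda>i. (- s) * (x i / (a i)\<^sup>2)) {1..n}"
      unfolding dist_Rn_def by (intro L2_set_cong) (auto simp: path_i)
    then show ?thesis unfolding L2_set_scale ell_normal_def by simp
  qed
  have ell_norm_path: "ell_norm (path s) = L2_set (\<lambda>i. (x i + s * (x i / (a i)\<^sup>2)) / a i) {1..n}" for s
    unfolding ell_norm_def by (intro L2_set_cong) (auto simp: path_i)
  have cont: "continuous_on A (\<lambda>s. ell_norm (path s))" for A
    unfolding ell_norm_path L2_set_def by (intro continuous_intros) (use pos in force)+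
  define \<delta> where "\<delta> = (1 - \<theta>)\<^sup>2 * \<epsilon>"
  have t1: "(1 - \<theta>)\<^sup>2 < 1" "(1 - \<theta>)\<^sup>2 > 0" using \<theta> by (auto simp: power_less_one_iff)
  have \<delta>: "0 < \<delta>" "\<delta> < \<epsilon>" using t1 \<epsilon> by (auto simp: \<delta>_def)
  have "\<delta> * slope x \<le> \<epsilon> * kmax"
    using \<delta> slope_le[of x] by (intro mult_mono) auto
  then have gx: "ell_norm x > 0" using x(1) \<epsilon> unfolding \<delta>_def[symmetric] by (simp add: mult.commute)
  have nx: "ell_normal x = ell_norm x * slope x" using gx by (simp add: slope_def)
  have sx: "slope x > 0" using slope_ge[OF gx] kmin_pos by linarith
  have nx0: "ell_normal x > 0" using gx sx nx by simp
  have p0: "ell_norm (path 0) = ell_norm x" unfolding ell_norm_path by (simp add: ell_norm_def)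
  have sumsq: "(\<Sum>i=1..n. (x i / (a i)\<^sup>2) * (s * (x i / (a i)\<^sup>2))) = s * (ell_normal x)\<^sup>2" for s
    unfolding ell_normal_def power2_L2_set sum_distrib_left by (intro sum.cong) (auto simp: power2_eq_square)
  show ?thesis
  proof (cases "ell_norm x < 1")
    case True
    define s where "s = \<delta> / ell_normal x"
    have s: "s > 0" "s * ell_normal x = \<delta>" using \<delta> nx0 by (auto simp: s_def)
    have "s * (ell_normal x)\<^sup>2 = (\<Sum>i=1..n. x i / (a i)\<^sup>2 * (path s i - x i))"
      unfolding sumsq[symmetric] by (intro sum.cong) (auto simp: path_i)
    also have "\<dots> \<le> ell_norm x * (ell_norm (path s) - ell_norm x)"
      by (rule ell_norm_subgradient)
    also have "s * (ell_normal x)\<^sup>2 = ell_norm x * (\<delta> * slope x)"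
      using s(2) nx by (simp add: power2_eq_square mult_ac)
    finally have "\<delta> * slope x \<le> ell_norm (path s) - ell_norm x"
      using gx by (simp add: mult_le_cancel_left_pos)
    then have "1 \<le> ell_norm (path s)" using x(1) by (simp add: \<delta>_def)
    then obtain r where r: "0 \<le> r" "r \<le> s" "ell_norm (path r) = 1"
      using IVT'[of "\<lambda>s. ell_norm (path s)" 0 1 s] cont True s p0 by auto
    have "r * ell_normal x \<le> \<delta>" using r nx0 s by (metis mult_right_mono less_imp_le)
    then have "dist_Rn n x (path r) < \<epsilon>" unfolding dist_path using r \<delta> by simp
    with r path_Rn show ?thesis by blast
  next
    case False
    define s where "s = (1 - \<theta>) * \<epsilon> / ell_normal x"
    have s: "s > 0" "s * ell_normal x = (1 - \<theta>) * \<epsilon>" using \<epsilon> \<theta> nx0 by (auto simp: s_def)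
    have "kmin \<le> ell_normal x" using ell_normal_ge[of x] False kmin_pos
      by (smt (verit) mult_left_le mult_le_cancel_left1)
    then have "s * kmin \<le> s * ell_normal x" using s(1) by (intro mult_left_mono) auto
    also have "\<dots> \<le> \<epsilon>" using s \<theta> \<epsilon> by simp
    finally have "kmax\<^sup>2 * (s * kmin) \<le> kmax\<^sup>2 * \<epsilon>" by (intro mult_left_mono) auto
    with \<epsilon>(3) have "(s * kmax\<^sup>2) * kmin \<le> \<theta> * kmin" by (simp add: mult_ac)
    then have sk: "s * kmax\<^sup>2 \<le> \<theta>" using kmin_pos by simp
    have si: "0 \<le> s / (a i)\<^sup>2" "s / (a i)\<^sup>2 \<le> \<theta>" if i: "i \<in> {1..n}" for i
    proof -
      have "(1 / a i)\<^sup>2 \<le> kmax\<^sup>2" using kmax[OF i] pos[OF i] by (intro power_mono) auto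
      then have "s * (1 / a i)\<^sup>2 \<le> s * kmax\<^sup>2" using s by simp
      then show "s / (a i)\<^sup>2 \<le> \<theta>" using sk by (simp add: power_divide)
      show "0 \<le> s / (a i)\<^sup>2" using s by simp
    qed
    define y where "y = path (- s)"
    have yi: "y i = (1 - s / (a i)\<^sup>2) * x i" if "i \<in> {1..n}" for i
      using path_i[OF that, of "-s"] by (simp add: y_def algebra_simps)
    have y_le: "ell_norm y \<le> ell_norm x"
      unfolding ell_norm_def
    proof (intro L2_set_abs_mono)
      fix i assume i: "i \<in> {1..n}"
      have "\<bar>1 - s / (a i)\<^sup>2\<bar> \<le> 1" using si[OF i] \<theta> by auto
      from mult_right_mono[OF this, of "\<bar>x i / a i\<bar>"] show "\<bar>y i / a i\<bar> \<le> \<bar>x i / a i\<bar>"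
        by (simp add: yi[OF i] abs_mult)
    qed
    \<comment> \<open>If the norm of \<open>y\<close> still exceeded 1, convexity at \<open>y\<close> would bound the drop from \<open>x\<close> to \<open>y\<close> below by \<open>\<delta> * slope x\<close>.\<close>
    have "ell_norm y \<le> 1"
    proof (rule ccontr)
      assume "\<not> ell_norm y \<le> 1"
      then have gy: "ell_norm y > 1" by simp
      have "(1 - \<theta>) * (s * (ell_normal x)\<^sup>2) \<le> (\<Sum>i=1..n. y i / (a i)\<^sup>2 * (x i - y i))"
        unfolding sumsq[symmetric] sum_distrib_left
      proof (intro sum_mono)
        fix i assume i: "i \<in> {1..n}"
        have "x i - y i = s * (x i / (a i)\<^sup>2)"
          by (simp add: yi[OF i] algebra_simps)
        then have prd: "y i / (a i)\<^sup>2 * (x i - y i) = (1 - s / (a i)\<^sup>2) * (x i / (a i)\<^sup>2 * (s * (x i / (a i)\<^sup>2)))"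
          by (simp only: yi[OF i] mult.assoc times_divide_eq_right[symmetric])
        have "x i / (a i)\<^sup>2 * (s * (x i / (a i)\<^sup>2)) = s * (x i / (a i)\<^sup>2)\<^sup>2"
          by (simp add: power2_eq_square)
        then have "0 \<le> x i / (a i)\<^sup>2 * (s * (x i / (a i)\<^sup>2))" using s by simp
        then show "(1 - \<theta>) * (x i / (a i)\<^sup>2 * (s * (x i / (a i)\<^sup>2))) \<le> y i / (a i)\<^sup>2 * (x i - y i)"
          unfolding prd using si[OF i] by (intro mult_right_mono) auto
      qed
      also have "\<dots> \<le> ell_norm y * (ell_norm x - ell_norm y)"
        by (rule ell_norm_subgradient)
      also have "\<dots> \<le> ell_norm x * (ell_norm x - ell_norm y)"
        using y_le by (intro mult_right_mono) auto
      also have "(1 - \<theta>) * (s * (ell_normal x)\<^sup>2) = (1 - \<theta>) * (s * ell_normal x) * ell_normal x"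
        by (simp add: power2_eq_square)
      also have "\<dots> = ell_norm x * (\<delta> * slope x)"
        unfolding s(2) \<delta>_def by (simp add: nx power2_eq_square)
      finally have "\<delta> * slope x \<le> ell_norm x - ell_norm y"
        using gx by (simp add: mult_le_cancel_left_pos)
      with x(2) gy show False by (simp add: \<delta>_def)
    qed
    then obtain r where r: "-s \<le> r" "r \<le> 0" "ell_norm (path r) = 1"
      using IVT'[of "\<lambda>s. ell_norm (path s)" "-s" 1 0] cont False s p0 by (auto simp: y_def)
    have "\<bar>r\<bar> * ell_normal x \<le> s * ell_normal x" using r nx0 by (intro mult_right_mono) auto
    also have "\<dots> < \<epsilon>" using s \<theta> \<epsilon> by simp
    finally show ?thesis using dist_path r path_Rn by metis
  qed
qed

end

section \<open>Boundary, tubes and polar integrals\<close>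

text \<open>
  The product sigma-algebra has all open sets: an open set is the union of the countably many cubes
  with rational centre and radius \<open>1 / (k + 1)\<close> that it contains.
\<close>

lemma sets_lebesgue_Rn_openI:
  assumes sub: "U \<subseteq> Rn n"
    and op: "\<And>x. x \<in> U \<Longrightarrow> \<exists>\<delta>>0. \<forall>y\<in>Rn n. (\<forall>i\<in>{1..n}. \<bar>y i - x i\<bar> < \<delta>) \<longrightarrow> y \<in> U"
  shows "U \<in> sets (lebesgue_Rn n)"
proof -
  define cube where "cube = (\<lambda>(c :: nat \<Rightarrow> real, k). \<Pi>\<^sub>E i\<in>{1..n}. ball (c i) (1 / real (Suc k)))"
  define C where "C = {ck \<in> (\<Pi>\<^sub>E i\<in>{1..n}. \<rat>) \<times> UNIV. cube ck \<subseteq> U}"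
  have "countable ((\<Pi>\<^sub>E i\<in>{1..n}. (\<rat> :: real set)) \<times> (UNIV :: nat set))"
    by (intro countable_SIGMA countable_PiE) (auto simp: countable_rat)
  then have C: "countable C" by (rule countable_subset[rotated]) (auto simp: C_def)
  have "U = (\<Union>ck\<in>C. cube ck)"
  proof (intro equalityI subsetI)
    fix x assume x: "x \<in> U"
    from op[OF x] obtain \<delta> where \<delta>: "\<delta> > 0"
      "\<And>y. y \<in> Rn n \<Longrightarrow> (\<And>i. i \<in> {1..n} \<Longrightarrow> \<bar>y i - x i\<bar> < \<delta>) \<Longrightarrow> y \<in> U" by blast
    obtain k where k: "1 / real (Suc k) < \<delta> / 2"
      using nat_approx_posE[of "\<delta> / 2"] \<delta>(1) by auto
    have "\<exists>q\<in>\<rat>. \<bar>q - x i\<bar> < 1 / real (Suc k)" for i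
    proof -
      obtain q where "q \<in> \<rat>" "x i < q" "q < x i + 1 / real (Suc k)"
        using Rats_dense_in_real[of "x i" "x i + 1 / real (Suc k)"] by auto
      then show ?thesis by (intro bexI[of _ q]) auto
    qed
    then obtain q where q: "\<And>i. q i \<in> \<rat>" "\<And>i. \<bar>q i - x i\<bar> < 1 / real (Suc k)" by metis
    have "x \<in> cube (restrict q {1..n}, k)"
      using x sub q by (auto simp: cube_def dist_real_def Rn_def PiE_iff)
    moreover have "cube (restrict q {1..n}, k) \<subseteq> U"
    proof
      fix y assume y: "y \<in> cube (restrict q {1..n}, k)"
      show "y \<in> U"
      proof (rule \<delta>(2))
        show "y \<in> Rn n" using y by (auto simp: cube_def Rn_def PiE_iff)
        fix i assume i: "i \<in> {1..n}"
        have "\<bar>q i - y i\<bar> < 1 / real (Suc k)"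
          using y i by (auto simp: cube_def dist_real_def PiE_iff)
        with q(2)[of i] k show "\<bar>y i - x i\<bar> < \<delta>" by linarith
      qed
    qed
    moreover have "(restrict q {1..n}, k) \<in> (\<Pi>\<^sub>E i\<in>{1..n}. \<rat>) \<times> UNIV" using q by auto
    ultimately show "x \<in> (\<Union>ck\<in>C. cube ck)" unfolding C_def by blast
  qed (auto simp: C_def)
  moreover have "cube ck \<in> sets (lebesgue_Rn n)" for ck
    unfolding cube_def by (auto simp: split_beta intro!: sets_PiM_I_finite)
  ultimately show ?thesis using C by (auto intro!: sets.countable_UN')
qed

text \<open>
  Measurability matters here, because \<open>measure\<close> gives the value \<open>0\<close> to every set outside the
  sigma-algebra. A tube is open, whatever \<open>S\<close> is.
\<close>

lemma sets_tube: "tube n \<epsilon> S \<in> sets (lebesgue_Rn n)"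
proof (rule sets_lebesgue_Rn_openI)
  fix x assume "x \<in> tube n \<epsilon> S"
  then obtain y where y: "y \<in> S" "dist_Rn n x y < \<epsilon>" by (auto simp: tube_def)
  define \<delta> where "\<delta> = (\<epsilon> - dist_Rn n x y) / real (Suc n)"
  have "\<delta> > 0" using y by (simp add: \<delta>_def)
  moreover have "z \<in> tube n \<epsilon> S" if z: "z \<in> Rn n" "\<forall>i\<in>{1..n}. \<bar>z i - x i\<bar> < \<delta>" for z
  proof -
    have "dist_Rn n z y \<le> L2_set (\<lambda>i. z i - x i) {1..n} + dist_Rn n x y"
      using L2_set_triangle_ineq[of "\<lambda>i. z i - x i" "\<lambda>i. x i - y i" "{1..n}"] by (simp add: dist_Rn_def)
    also have "L2_set (\<lambda>i. z i - x i) {1..n} \<le> (\<Sum>i=1..n. \<bar>z i - x i\<bar>)"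
      by (rule L2_set_le_sum_abs)
    also have "\<dots> \<le> (\<Sum>i=1..n. \<delta>)" using z by (intro sum_mono) (auto intro: less_imp_le)
    also have "\<dots> = real n * \<delta>" by simp
    also have "\<dots> < real (Suc n) * \<delta>" using \<open>\<delta> > 0\<close> by simp
    also have "\<dots> = \<epsilon> - dist_Rn n x y" unfolding \<delta>_def by (simp del: of_nat_Suc)
    finally show ?thesis using z y by (auto simp: tube_def)
  qed
  ultimately show "\<exists>\<delta>>0. \<forall>z\<in>Rn n. (\<forall>i\<in>{1..n}. \<bar>z i - x i\<bar> < \<delta>) \<longrightarrow> z \<in> tube n \<epsilon> S" by blast
qed (auto simp: tube_def)

lemma nn_integral_power_Ioc:
  assumes "n \<ge> 1" "c \<ge> 0"
  shows "(\<integral>\<^sup>+r. ennreal (real n * r ^ (n - 1)) * indicator {0<..c} r \<partial>lborel) = ennreal (c ^ n)"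
proof -
  have "AE r in lborel. r \<noteq> (0::real)" by (rule AE_lborel_singleton)
  then have "(\<integral>\<^sup>+r. ennreal (real n * r ^ (n - 1)) * indicator {0<..c} r \<partial>lborel) =
        (\<integral>\<^sup>+r. ennreal (real n * r ^ (n - 1)) * indicator {0..c} r \<partial>lborel)"
    by (intro nn_integral_cong_AE) (auto elim!: eventually_mono simp: indicator_def)
  with nn_integral_power_Icc[OF assms] show ?thesis by simp
qed

context semiaxes
begin

lemma topspace_Rn: "topspace (powertop_real {1..n}) = Rn n"
  by (simp add: Rn_def)

lemma continuous_map_ell_norm: "continuous_map (powertop_real {1..n}) euclideanreal ell_norm"
proof -
  have "continuous_map (powertop_real {1..n}) euclideanreal (\<lambda>x. (x i / a i)\<^sup>2)" if "i \<in> {1..n}" for i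
    using continuous_map_product_projection[OF that, of "\<lambda>_. euclideanreal"] pos[OF that]
    by (intro continuous_intros) (use that in auto)
  then have "continuous_map (powertop_real {1..n}) euclideanreal (\<lambda>x. \<Sum>i=1..n. (x i / a i)\<^sup>2)"
    by (intro continuous_map_sum) auto
  moreover have "continuous_map euclideanreal euclideanreal sqrt"
    by (simp add: continuous_on_real_sqrt continuous_on_id)
  ultimately have "continuous_map (powertop_real {1..n}) euclideanreal (sqrt \<circ> (\<lambda>x. \<Sum>i=1..n. (x i / a i)\<^sup>2))"
    by (rule continuous_map_compose)
  then show ?thesis by (simp add: o_def ell_norm_def[abs_def] L2_set_def)
qed

text \<open>
  A point of norm \<open>1\<close> is not interior, because dilating it by a factor slightly above \<open>1\<close> leaves
  the ellipsoid.
\<close>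

lemma boundary_ellipsoid: "boundary n (ellipsoid a n) = {x \<in> Rn n. ell_norm x = 1}"
proof -
  let ?X = "powertop_real {1..n}"
  have cl: "closedin ?X (ellipsoid a n)"
    using closedin_continuous_map_preimage[OF continuous_map_ell_norm, of "{..1}"]
    unfolding topspace_Rn by (simp add: ellipsoid_eq)
  have "openin ?X {x \<in> Rn n. ell_norm x < 1}"
    using openin_continuous_map_preimage[OF continuous_map_ell_norm, of "{..<1}"]
    unfolding topspace_Rn by simp
  then have int: "{x \<in> Rn n. ell_norm x < 1} \<subseteq> ?X interior_of (ellipsoid a n)"
    by (intro interior_of_maximal) (auto simp: ellipsoid_eq)
  have "x \<notin> ?X interior_of (ellipsoid a n)" if x: "x \<in> Rn n" "ell_norm x = 1" for x
  proof
    assume "x \<in> ?X interior_of (ellipsoid a n)"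
    then obtain U where U: "openin ?X U" "x \<in> U" "U \<subseteq> ellipsoid a n"
      by (auto simp: interior_of_def)
    have "continuous_map euclideanreal ?X (\<lambda>t. dilate n t x)"
      unfolding continuous_map_componentwise
      by (auto simp: dilate_def intro!: continuous_intros)
    then have "openin euclideanreal {t \<in> topspace euclideanreal. dilate n t x \<in> U}"
      using U(1) by (rule openin_continuous_map_preimage)
    then have "open {t. dilate n t x \<in> U}" by simp
    moreover have "1 \<in> {t. dilate n t x \<in> U}" using U(2) x(1) by simp
    ultimately obtain e where e: "e > 0" "ball 1 e \<subseteq> {t. dilate n t x \<in> U}"
      using open_contains_ball by blast
    have "1 + e / 2 \<in> ball 1 e" using e(1) by (simp add: dist_real_def)
    then have "dilate n (1 + e / 2) x \<in> ellipsoid a n" using e(2) U(3) by blast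
    then have "(1 + e / 2) * ell_norm x \<le> 1" using e(1) by (simp add: ellipsoid_eq ell_norm_dilate)
    with x e(1) show False by simp
  qed
  moreover have "?X interior_of (ellipsoid a n) \<subseteq> ellipsoid a n" by (rule interior_of_subset)
  ultimately show ?thesis
    using int unfolding boundary_def frontier_of_def closure_of_closedin[OF cl]
    by (fastforce simp: ellipsoid_eq)
qed

lemma measurable_coordinate [measurable]:
  "i \<in> {1..n} \<Longrightarrow> (\<lambda>x. x i) \<in> borel_measurable (lebesgue_Rn n)"
  using measurable_component_singleton[of i "{1..n}" "\<lambda>_. lborel :: real measure"] by simp

lemma measurable_ell_norm [measurable]: "ell_norm \<in> borel_measurable (lebesgue_Rn n)"
proof -
  have "(\<lambda>x. \<Sum>i=1..n. (x i / a i)\<^sup>2) \<in> borel_measurable (lebesgue_Rn n)"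
    by (intro borel_measurable_sum borel_measurable_power borel_measurable_divide measurable_coordinate) auto
  then show ?thesis unfolding ell_norm_def[abs_def] L2_set_def by measurable
qed

lemma measurable_slope [measurable]: "slope \<in> borel_measurable (lebesgue_Rn n)"
proof -
  have "(\<lambda>x. \<Sum>i=1..n. (x i / (a i)\<^sup>2)\<^sup>2) \<in> borel_measurable (lebesgue_Rn n)"
    by (intro borel_measurable_sum borel_measurable_power borel_measurable_divide measurable_coordinate) auto
  then have "ell_normal \<in> borel_measurable (lebesgue_Rn n)" unfolding ell_normal_def[abs_def] L2_set_def by measurable
  then show ?thesis unfolding slope_def[abs_def] by measurable
qed

lemma sets_ellipsoid [measurable]: "ellipsoid a n \<in> sets (lebesgue_Rn n)"
proof -
  have "{x \<in> space (lebesgue_Rn n). ell_norm x \<le> 1} \<in> sets (lebesgue_Rn n)" by measurable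
  then show ?thesis unfolding ellipsoid_eq by (simp only: space_lebesgue_Rn)
qed

lemma AE_ell_norm_pos: "AE x in lebesgue_Rn n. ell_norm x > 0"
proof -
  have "{x \<in> Rn n. ell_norm x = 0} = (\<Pi>\<^sub>E i\<in>{1..n}. {0})"
    unfolding ell_norm_eq_0_iff Rn_def by (auto simp: PiE_iff extensional_def fun_eq_iff restrict_def)
  also have "emeasure (lebesgue_Rn n) \<dots> = (\<Prod>i=1..n. emeasure lborel {0::real})"
    by (rule lborel_product.emeasure_PiM) auto
  also have "\<dots> = 0" using n_pos by (simp add: power_0_left)
  finally have "{x \<in> space (lebesgue_Rn n). ell_norm x = 0} \<in> null_sets (lebesgue_Rn n)"
    unfolding space_lebesgue_Rn[symmetric] by (intro null_setsI) measurable
  from AE_not_in[OF this] AE_space show ?thesis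
    by eventually_elim (auto simp: less_le)
qed

text \<open>
  The origin can be dropped from the left-hand side of the polar formula because it is a null set.
\<close>

lemma nn_integral_polar_ellipsoid:
  assumes [measurable]: "F \<in> borel_measurable (lebesgue_Rn n)"
  shows "(\<integral>\<^sup>+x. F x \<partial>lebesgue_Rn n) =
         (\<integral>\<^sup>+x. (\<integral>\<^sup>+r. ennreal (real n * r ^ (n - 1)) * F (dilate n (r / ell_norm x) x) * indicator {0<..} r \<partial>lborel)
               * indicator {x. 0 < ell_norm x \<and> ell_norm x \<le> 1} x \<partial>lebesgue_Rn n)"
proof -
  have "(\<integral>\<^sup>+x. F x \<partial>lebesgue_Rn n) = (\<integral>\<^sup>+x. F x * indicator {x. 0 < ell_norm x} x \<partial>lebesgue_Rn n)"
    using AE_ell_norm_pos by (intro nn_integral_cong_AE) (auto elim!: eventually_mono)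
  also have "\<dots> = (\<integral>\<^sup>+x. (\<integral>\<^sup>+r. ennreal (real n * r ^ (n - 1)) * F (dilate n (r / ell_norm x) x) * indicator {0<..} r \<partial>lborel)
               * indicator {x. 0 < ell_norm x \<and> ell_norm x \<le> 1} x \<partial>lebesgue_Rn n)"
    by (intro nn_integral_polar n_pos measurable_ell_norm assms) (simp add: ell_norm_dilate)
  finally show ?thesis .
qed

text \<open>
  In polar coordinates the set is \<open>r \<le> \<phi> x\<close>, and the integral of \<open>n * r ^ (n - 1)\<close> over \<open>0 < r \<le> \<phi> x\<close>
  is \<open>\<phi> x ^ n\<close>.
\<close>

lemma emeasure_star_shaped:
  assumes [measurable]: "\<phi> \<in> borel_measurable (lebesgue_Rn n)"
    and pos\<phi>: "\<And>x. x \<in> Rn n \<Longrightarrow> \<phi> x \<ge> 0"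
    and hom: "\<And>x r. x \<in> Rn n \<Longrightarrow> r > 0 \<Longrightarrow> \<phi> (dilate n r x) = \<phi> x"
  shows "emeasure (lebesgue_Rn n) {x \<in> Rn n. ell_norm x \<le> \<phi> x} =
         (\<integral>\<^sup>+x. ennreal (\<phi> x ^ n) * indicator (ellipsoid a n) x \<partial>lebesgue_Rn n)"
proof -
  let ?D = "{x \<in> space (lebesgue_Rn n). ell_norm x \<le> \<phi> x}"
  have D [measurable]: "?D \<in> sets (lebesgue_Rn n)" by measurable
  have "emeasure (lebesgue_Rn n) ?D = (\<integral>\<^sup>+x. indicator ?D x \<partial>lebesgue_Rn n)"
    using D by simp
  also have "\<dots> = (\<integral>\<^sup>+x. (\<integral>\<^sup>+r. ennreal (real n * r ^ (n - 1)) * indicator ?D (dilate n (r / ell_norm x) x) * indicator {0<..} r \<partial>lborel)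
               * indicator {x. 0 < ell_norm x \<and> ell_norm x \<le> 1} x \<partial>lebesgue_Rn n)"
    by (rule nn_integral_polar_ellipsoid) measurable
  also have "\<dots> = (\<integral>\<^sup>+x. ennreal (\<phi> x ^ n) * indicator (ellipsoid a n) x \<partial>lebesgue_Rn n)"
  proof (rule nn_integral_cong_AE)
    show "AE x in lebesgue_Rn n. (\<integral>\<^sup>+r. ennreal (real n * r ^ (n - 1)) * indicator ?D (dilate n (r / ell_norm x) x) * indicator {0<..} r \<partial>lborel)
               * indicator {x. 0 < ell_norm x \<and> ell_norm x \<le> 1} x = ennreal (\<phi> x ^ n) * indicator (ellipsoid a n) x"
      using AE_ell_norm_pos AE_space
    proof eventually_elim
      case (elim x)
      then have x: "x \<in> Rn n" by (simp only: space_lebesgue_Rn)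
      have "(\<integral>\<^sup>+r. ennreal (real n * r ^ (n - 1)) * indicator ?D (dilate n (r / ell_norm x) x) * indicator {0<..} r \<partial>lborel)
          = (\<integral>\<^sup>+r. ennreal (real n * r ^ (n - 1)) * indicator {0<..\<phi> x} r \<partial>lborel)"
      proof (intro nn_integral_cong)
        fix r :: real
        show "ennreal (real n * r ^ (n - 1)) * indicator ?D (dilate n (r / ell_norm x) x) * indicator {0<..} r
            = ennreal (real n * r ^ (n - 1)) * indicator {0<..\<phi> x} r"
        proof (cases "r > 0")
          case True
          have "dilate n (r / ell_norm x) x \<in> ?D \<longleftrightarrow> r \<le> \<phi> x"
            unfolding space_lebesgue_Rn using True elim hom[OF x, of "r / ell_norm x"] by (simp add: ell_norm_dilate)
          with True show ?thesis by (simp add: indicator_def)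
        qed simp
      qed
      also have "\<dots> = ennreal (\<phi> x ^ n)"
        using n_pos pos\<phi>[OF x] by (rule nn_integral_power_Ioc)
      finally show ?case using elim x by (auto simp: ellipsoid_eq indicator_def)
    qed
  qed
  finally show ?thesis by (simp only: space_lebesgue_Rn)
qed

text \<open>
  The joint density of independent centred normal coordinates with standard deviations \<open>a i\<close>. This
  choice of the deviations makes it a function of \<open>ell_norm\<close> alone.
\<close>

definition gauss_weight :: "(nat \<Rightarrow> real) \<Rightarrow> real" where
  "gauss_weight x = (\<Prod>i=1..n. normal_density 0 (a i) (x i))"

lemma gauss_weight_nonneg: "gauss_weight x \<ge> 0"
  unfolding gauss_weight_def by (intro prod_nonneg) auto

lemma measurable_gauss_weight [measurable]: "gauss_weight \<in> borel_measurable (lebesgue_Rn n)"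
  unfolding gauss_weight_def[abs_def]
  by (intro borel_measurable_prod measurable_compose[OF measurable_coordinate borel_measurable_normal_density])

lemma gauss_weight_eq:
  "gauss_weight x = (\<Prod>i=1..n. 1 / sqrt (2 * pi * (a i)\<^sup>2)) * exp (- (ell_norm x)\<^sup>2 / 2)"
proof -
  have "exp (- (ell_norm x)\<^sup>2 / 2) = (\<Prod>i=1..n. exp (- (x i)\<^sup>2 / (2 * (a i)\<^sup>2)))"
    unfolding power2_ell_norm by (simp add: exp_sum[symmetric] sum_divide_distrib sum_negf mult.commute)
  then show ?thesis
    unfolding gauss_weight_def normal_density_def by (simp add: prod.distrib prod_dividef)
qed

lemma nn_integral_gauss_weight: "(\<integral>\<^sup>+x. ennreal (gauss_weight x) \<partial>lebesgue_Rn n) = 1"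
proof -
  have "(\<integral>\<^sup>+x. ennreal (gauss_weight x) \<partial>lebesgue_Rn n) =
        (\<integral>\<^sup>+x. (\<Prod>i=1..n. ennreal (normal_density 0 (a i) (x i))) \<partial>lebesgue_Rn n)"
    unfolding gauss_weight_def by (intro nn_integral_cong) (simp add: prod_ennreal)
  also have "\<dots> = (\<Prod>i=1..n. \<integral>\<^sup>+t. ennreal (normal_density 0 (a i) t) \<partial>lborel)"
    by (intro lborel_product.product_nn_integral_prod) auto
  also have "\<dots> = (\<Prod>i=1..n. 1)"
    using pos by (intro prod.cong refl) (auto simp: nn_integral_eq_integral)
  finally show ?thesis by simp
qed

text \<open>
  The radial part of the integral of \<open>gauss_weight\<close>. It need not be computed: the total mass
  \<open>1\<close> of the density identifies it with the inverse of the volume of the ellipsoid.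
\<close>

definition gauss_radial :: ennreal where
  "gauss_radial = (\<integral>\<^sup>+r. ennreal (real n * r ^ (n - 1)) * 
     ennreal ((\<Prod>i=1..n. 1 / sqrt (2 * pi * (a i)\<^sup>2)) * exp (- r\<^sup>2 / 2)) * indicator {0<..} r \<partial>lborel)"

text \<open>
  A function that is constant along rays factors out of the radial integral, so integrals against
  any two radial weights, here the Gaussian density and the indicator of the ellipsoid, are
  proportional.
\<close>

lemma nn_integral_homogeneous_gauss:
  assumes [measurable]: "\<psi> \<in> borel_measurable (lebesgue_Rn n)"
    and hom: "\<And>x r. x \<in> Rn n \<Longrightarrow> r > 0 \<Longrightarrow> \<psi> (dilate n r x) = \<psi> x"
  shows "(\<integral>\<^sup>+x. \<psi> x * ennreal (gauss_weight x) \<partial>lebesgue_Rn n) =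
         gauss_radial * (\<integral>\<^sup>+x. \<psi> x * indicator (ellipsoid a n) x \<partial>lebesgue_Rn n)"
proof -
  have "(\<integral>\<^sup>+x. \<psi> x * ennreal (gauss_weight x) \<partial>lebesgue_Rn n) = 
     (\<integral>\<^sup>+x. (\<integral>\<^sup>+r. ennreal (real n * r ^ (n - 1)) * (\<psi> (dilate n (r / ell_norm x) x) * ennreal (gauss_weight (dilate n (r / ell_norm x) x))) * indicator {0<..} r \<partial>lborel)
               * indicator {x. 0 < ell_norm x \<and> ell_norm x \<le> 1} x \<partial>lebesgue_Rn n)"
    by (rule nn_integral_polar_ellipsoid) measurable
  also have "\<dots> = (\<integral>\<^sup>+x. gauss_radial * (\<psi> x * indicator (ellipsoid a n) x) \<partial>lebesgue_Rn n)"
  proof (rule nn_integral_cong_AE)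
    show "AE x in lebesgue_Rn n. (\<integral>\<^sup>+r. ennreal (real n * r ^ (n - 1)) * (\<psi> (dilate n (r / ell_norm x) x) * ennreal (gauss_weight (dilate n (r / ell_norm x) x))) * indicator {0<..} r \<partial>lborel)
               * indicator {x. 0 < ell_norm x \<and> ell_norm x \<le> 1} x = gauss_radial * (\<psi> x * indicator (ellipsoid a n) x)"
      using AE_ell_norm_pos AE_space
    proof eventually_elim
      case (elim x)
      then have x: "x \<in> Rn n" by (simp only: space_lebesgue_Rn)
      have "(\<integral>\<^sup>+r. ennreal (real n * r ^ (n - 1)) * (\<psi> (dilate n (r / ell_norm x) x) * ennreal (gauss_weight (dilate n (r / ell_norm x) x))) * indicator {0<..} r \<partial>lborel)
        = (\<integral>\<^sup>+r. \<psi> x * (ennreal (real n * r ^ (n - 1)) * 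
     ennreal ((\<Prod>i=1..n. 1 / sqrt (2 * pi * (a i)\<^sup>2)) * exp (- r\<^sup>2 / 2)) * indicator {0<..} r) \<partial>lborel)"
      proof (intro nn_integral_cong)
        fix r :: real
        show "ennreal (real n * r ^ (n - 1)) * (\<psi> (dilate n (r / ell_norm x) x) * ennreal (gauss_weight (dilate n (r / ell_norm x) x))) * indicator {0<..} r
          = \<psi> x * (ennreal (real n * r ^ (n - 1)) * 
     ennreal ((\<Prod>i=1..n. 1 / sqrt (2 * pi * (a i)\<^sup>2)) * exp (- r\<^sup>2 / 2)) * indicator {0<..} r)"
        proof (cases "r > 0")
          case True
          then show ?thesis
            using elim hom[OF x, of "r / ell_norm x"]
            by (simp add: gauss_weight_eq ell_norm_dilate mult_ac del: of_nat_prod)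
        qed simp
      qed
      also have "\<dots> = \<psi> x * gauss_radial"
        unfolding gauss_radial_def by (rule nn_integral_cmult) simp
      finally show ?case using elim x by (auto simp: ellipsoid_eq indicator_def mult_ac)
    qed
  qed
  also have "\<dots> = gauss_radial * (\<integral>\<^sup>+x. \<psi> x * indicator (ellipsoid a n) x \<partial>lebesgue_Rn n)"
    by (intro nn_integral_cmult borel_measurable_times_ennreal borel_measurable_indicator assms sets_ellipsoid)
  finally show ?thesis .
qed

lemma gauss_radial_mult: "gauss_radial * emeasure (lebesgue_Rn n) (ellipsoid a n) = 1"
  using nn_integral_homogeneous_gauss[of "\<lambda>_. 1"] nn_integral_gauss_weight
  by (simp only: nn_integral_indicator[OF sets_ellipsoid] mult_1 borel_measurable_const)

text \<open>
  The ellipsoid has finite volume, since otherwise the product in \<open>gauss_radial_mult\<close> would be \<open>0\<close>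
  or infinite.
\<close>

lemma emeasure_ellipsoid:
  "emeasure (lebesgue_Rn n) (ellipsoid a n) \<noteq> \<infinity>"
  using gauss_radial_mult by (auto simp: ennreal_mult_eq_top_iff ennreal_mult_top split: if_splits)

lemma integral_homogeneous_gauss:
  assumes [measurable]: "\<psi> \<in> borel_measurable (lebesgue_Rn n)"
    and nonneg: "\<And>x. 0 \<le> \<psi> x"
    and hom: "\<And>x r. x \<in> Rn n \<Longrightarrow> r > 0 \<Longrightarrow> \<psi> (dilate n r x) = \<psi> x"
  shows "(\<integral>x. \<psi> x * gauss_weight x \<partial>lebesgue_Rn n) =
         (\<integral>x. \<psi> x * indicator (ellipsoid a n) x \<partial>lebesgue_Rn n) / volume n (ellipsoid a n)"
proof -
  have "(\<integral>\<^sup>+x. ennreal (\<psi> x * gauss_weight x) \<partial>lebesgue_Rn n) =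
        (\<integral>\<^sup>+x. ennreal (\<psi> x) * ennreal (gauss_weight x) \<partial>lebesgue_Rn n)"
    using nonneg gauss_weight_nonneg by (simp add: ennreal_mult)
  also have "\<dots> = gauss_radial * (\<integral>\<^sup>+x. ennreal (\<psi> x) * indicator (ellipsoid a n) x \<partial>lebesgue_Rn n)"
    by (intro nn_integral_homogeneous_gauss measurable_compose[OF assms(1) measurable_ennreal]) (simp add: hom)
  also have "(\<integral>\<^sup>+x. ennreal (\<psi> x) * indicator (ellipsoid a n) x \<partial>lebesgue_Rn n) =
             (\<integral>\<^sup>+x. ennreal (\<psi> x * indicator (ellipsoid a n) x) \<partial>lebesgue_Rn n)"
    by (intro nn_integral_cong) (simp add: indicator_def)
  finally have eq: "(\<integral>\<^sup>+x. ennreal (\<psi> x * gauss_weight x) \<partial>lebesgue_Rn n) =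
     gauss_radial * (\<integral>\<^sup>+x. ennreal (\<psi> x * indicator (ellipsoid a n) x) \<partial>lebesgue_Rn n)" .
  have "enn2real gauss_radial * volume n (ellipsoid a n) = 1"
    using arg_cong[OF gauss_radial_mult, of enn2real] by (simp add: volume_def measure_def enn2real_mult)
  then have "enn2real gauss_radial = 1 / volume n (ellipsoid a n)"
    by (auto simp: eq_divide_eq)
  moreover have "(\<integral>x. \<psi> x * gauss_weight x \<partial>lebesgue_Rn n) = enn2real (\<integral>\<^sup>+x. ennreal (\<psi> x * gauss_weight x) \<partial>lebesgue_Rn n)"
    by (intro integral_eq_nn_integral borel_measurable_times assms(1) measurable_gauss_weight
          AE_I2 mult_nonneg_nonneg nonneg gauss_weight_nonneg)
  moreover have "(\<integral>x. \<psi> x * indicator (ellipsoid a n) x \<partial>lebesgue_Rn n) =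
     enn2real (\<integral>\<^sup>+x. ennreal (\<psi> x * indicator (ellipsoid a n) x) \<partial>lebesgue_Rn n)"
    by (intro integral_eq_nn_integral borel_measurable_times borel_measurable_indicator assms(1) sets_ellipsoid
          AE_I2 mult_nonneg_nonneg nonneg indicator_pos_le)
  ultimately show ?thesis unfolding eq by (simp add: enn2real_mult)
qed

end

section \<open>The surface area of an ellipsoid\<close>

context semiaxes
begin

definition slope_moment :: "nat \<Rightarrow> real" where
  "slope_moment k = (\<integral>x. slope x ^ k * indicator (ellipsoid a n) x \<partial>lebesgue_Rn n)"

text \<open>
  The integral of \<open>(1 + s * slope x) ^ n\<close> over the ellipsoid, expanded as a polynomial in \<open>s\<close>, so that it
  can be differentiated without interchanging limit and integral.
\<close>

definition slope_volume :: "real \<Rightarrow> real" where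
  "slope_volume s = (\<Sum>k\<le>n. real (n choose k) * s ^ k * slope_moment k)"

lemma integrable_slope_power:
  "integrable (lebesgue_Rn n) (\<lambda>x. slope x ^ k * indicator (ellipsoid a n) x)"
proof (rule integrableI_bounded_set[where A="ellipsoid a n" and B="kmax ^ k"])
  show "(\<lambda>x. slope x ^ k * indicator (ellipsoid a n) x) \<in> borel_measurable (lebesgue_Rn n)"
    by (intro borel_measurable_times borel_measurable_power measurable_slope borel_measurable_indicator sets_ellipsoid)
  show "emeasure (lebesgue_Rn n) (ellipsoid a n) < \<infinity>"
    using emeasure_ellipsoid by (simp add: less_top)
  have "slope x ^ k \<le> kmax ^ k" for x by (intro power_mono slope_le) simp
  then show "AE x in lebesgue_Rn n. x \<in> ellipsoid a n \<longrightarrow> norm (slope x ^ k * indicator (ellipsoid a n) x) \<le> kmax ^ k"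
    by (intro AE_I2) simp
qed (rule sets_ellipsoid, auto)

lemma sublevel:
  assumes s: "\<bar>s\<bar> * kmax \<le> 1"
  shows "{x \<in> Rn n. ell_norm x \<le> 1 + s * slope x} \<in> sets (lebesgue_Rn n)"
    and "emeasure (lebesgue_Rn n) {x \<in> Rn n. ell_norm x \<le> 1 + s * slope x} = ennreal (slope_volume s)"
    and "slope_volume s \<ge> 0"
proof -
  have nonneg: "1 + s * slope x \<ge> 0" for x
  proof -
    have "\<bar>s\<bar> * slope x \<le> \<bar>s\<bar> * kmax" by (intro mult_left_mono slope_le) auto
    then have "\<bar>s * slope x\<bar> \<le> 1" using s by (simp add: abs_mult)
    then show ?thesis by linarith
  qed
  have "{x \<in> space (lebesgue_Rn n). ell_norm x \<le> 1 + s * slope x} \<in> sets (lebesgue_Rn n)"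
    by measurable
  then show "{x \<in> Rn n. ell_norm x \<le> 1 + s * slope x} \<in> sets (lebesgue_Rn n)"
    by (simp only: space_lebesgue_Rn)
  have expand: "(1 + s * slope x) ^ n * indicator (ellipsoid a n) x =
      (\<Sum>k\<le>n. real (n choose k) * s ^ k * (slope x ^ k * indicator (ellipsoid a n) x))" for x
  proof -
    have "(1 + s * slope x) ^ n = (\<Sum>k\<le>n. real (n choose k) * s ^ k * slope x ^ k)"
      using binomial_ring[of "s * slope x" 1 n] by (simp add: add.commute[of 1] power_mult_distrib mult.assoc)
    then show ?thesis by (simp only: sum_distrib_right mult.assoc)
  qed
  have int: "integrable (lebesgue_Rn n) (\<lambda>x. (1 + s * slope x) ^ n * indicator (ellipsoid a n) x)"
    unfolding expand by (intro Bochner_Integration.integrable_sum integrable_mult_right integrable_slope_power)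
  have vol: "(\<integral>x. (1 + s * slope x) ^ n * indicator (ellipsoid a n) x \<partial>lebesgue_Rn n) = slope_volume s"
    unfolding expand slope_volume_def slope_moment_def
    by (simp only: Bochner_Integration.integral_sum integrable_mult_right integrable_slope_power integral_mult_right_zero)
  show "slope_volume s \<ge> 0"
    unfolding vol[symmetric] using nonneg by (intro Bochner_Integration.integral_nonneg) simp
  have "emeasure (lebesgue_Rn n) {x \<in> Rn n. ell_norm x \<le> 1 + s * slope x} =
      (\<integral>\<^sup>+x. ennreal ((1 + s * slope x) ^ n) * indicator (ellipsoid a n) x \<partial>lebesgue_Rn n)"
    by (intro emeasure_star_shaped nonneg borel_measurable_add borel_measurable_times measurable_slope borel_measurable_const)
       (simp add: slope_dilate)
  also have "\<dots> = (\<integral>\<^sup>+x. ennreal ((1 + s * slope x) ^ n * indicator (ellipsoid a n) x) \<partial>lebesgue_Rn n)"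
    by (intro nn_integral_cong) (simp add: indicator_def)
  also have "\<dots> = ennreal (slope_volume s)"
    unfolding vol[symmetric] using nonneg by (intro nn_integral_eq_integral int AE_I2) simp
  finally show "emeasure (lebesgue_Rn n) {x \<in> Rn n. ell_norm x \<le> 1 + s * slope x} = ennreal (slope_volume s)" .
qed

text \<open>
  To first order, the distance of \<open>x\<close> from the level set of value \<open>1\<close> is
  \<open>\<bar>ell_norm x - 1\<bar> / slope x\<close>. So this shell approximates the tube of radius \<open>\<delta>\<close> around the boundary;
  unlike the tube, it has an explicit volume.
\<close>

definition shell :: "real \<Rightarrow> (nat \<Rightarrow> real) set" where
  "shell \<delta> = {x \<in> Rn n. 1 - \<delta> * slope x < ell_norm x \<and> ell_norm x \<le> 1 + \<delta> * slope x}"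

lemma shell:
  assumes \<delta>: "\<delta> \<ge> 0" "\<delta> * kmax \<le> 1"
  shows "shell \<delta> \<in> sets (lebesgue_Rn n)"
    and "emeasure (lebesgue_Rn n) (shell \<delta>) < \<infinity>"
    and "volume n (shell \<delta>) = slope_volume \<delta> - slope_volume (- \<delta>)"
proof -
  let ?A = "\<lambda>s. {x \<in> Rn n. ell_norm x \<le> 1 + s * slope x}"
  have s: "\<bar>\<delta>\<bar> * kmax \<le> 1" "\<bar>- \<delta>\<bar> * kmax \<le> 1" using \<delta> by auto
  note A = sublevel[OF s(1)] and B = sublevel[OF s(2)]
  have "1 + - \<delta> * slope x \<le> 1 + \<delta> * slope x" for x
    using \<delta>(1) mult_nonneg_nonneg[OF \<delta>(1) slope_nonneg[of x]] by simp
  then have sub: "?A (- \<delta>) \<subseteq> ?A \<delta>" by (blast intro: order_trans)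
  have eq: "shell \<delta> = ?A \<delta> - ?A (- \<delta>)" by (auto simp: shell_def)
  show "shell \<delta> \<in> sets (lebesgue_Rn n)" unfolding eq by (intro sets.Diff A B)
  have "emeasure (lebesgue_Rn n) (shell \<delta>) \<le> emeasure (lebesgue_Rn n) (?A \<delta>)"
    unfolding eq by (intro emeasure_mono A) auto
  also have "\<dots> < \<infinity>" unfolding A(2) by simp
  finally show "emeasure (lebesgue_Rn n) (shell \<delta>) < \<infinity>" .
  have "measure (lebesgue_Rn n) (shell \<delta>) = measure (lebesgue_Rn n) (?A \<delta>) - measure (lebesgue_Rn n) (?A (- \<delta>))"
    unfolding eq by (intro measure_Diff sub A B) (simp add: A(2) del: One_nat_def)
  then show "volume n (shell \<delta>) = slope_volume \<delta> - slope_volume (- \<delta>)"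
    unfolding volume_def measure_def A(2) B(2) using A(3) B(3) by simp
qed

lemma slope_volume_derivative: "(slope_volume has_real_derivative real n * slope_moment 1) (at 0)"
proof -
  have "((\<lambda>s. \<Sum>k\<le>n. real (n choose k) * s ^ k * slope_moment k) has_real_derivative
      (\<Sum>k\<le>n. real (n choose k) * (real k * 0 ^ (k - Suc 0)) * slope_moment k)) (at 0)"
    by (intro DERIV_sum DERIV_cmult_right DERIV_cmult) (rule DERIV_pow)
  also have "(\<Sum>k\<le>n. real (n choose k) * (real k * 0 ^ (k - Suc 0)) * slope_moment k) =
      (\<Sum>k\<le>n. if k = 1 then real n * slope_moment 1 else 0)"
    by (intro sum.cong) (auto simp: power_0_left)
  also have "\<dots> = real n * slope_moment 1" using n_pos by simp
  finally show ?thesis unfolding slope_volume_def[abs_def] .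
qed

lemma slope_volume_quotient:
  "((\<lambda>\<delta>. (slope_volume \<delta> - slope_volume (- \<delta>)) / (2 * \<delta>)) \<longlongrightarrow> real n * slope_moment 1) (at_right 0)"
proof -
  let ?D = "real n * slope_moment 1"
  have "((\<lambda>\<delta>. slope_volume \<delta> - slope_volume (- \<delta>)) has_real_derivative (?D - ?D * (- 1))) (at 0)"
    using DERIV_diff[OF slope_volume_derivative, of "\<lambda>\<delta>. slope_volume (- \<delta>)" "- ?D"]
      slope_volume_derivative DERIV_mirror[where f = slope_volume and x = 0 and y = ?D] by simp
  then have "((\<lambda>\<delta>. (slope_volume \<delta> - slope_volume (- \<delta>)) / \<delta>) \<longlongrightarrow> 2 * ?D) (at 0)"
    by (simp add: DERIV_def)
  then have "((\<lambda>\<delta>. (slope_volume \<delta> - slope_volume (- \<delta>)) / \<delta>) \<longlongrightarrow> 2 * ?D) (at_right 0)"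
    by (rule tendsto_within_subset) simp
  from tendsto_divide[OF this tendsto_const[of 2]] show ?thesis
    by (simp add: mult.commute)
qed

text \<open>
  The tube of radius \<open>\<epsilon>\<close> lies between the shells of thickness \<open>lo \<epsilon> * \<epsilon>\<close> and \<open>hi \<epsilon> * \<epsilon>\<close>, whose factors
  \<open>lo \<epsilon>\<close> and \<open>hi \<epsilon>\<close> tend to \<open>1\<close>. Squeezing also shows that the limit defining the surface area exists.
\<close>

lemma surface_area_ellipsoid:
  "surface_area n (boundary n (ellipsoid a n)) = real n * slope_moment 1"
proof -
  define T where "T = (\<lambda>\<epsilon>. volume n (tube n \<epsilon> (boundary n (ellipsoid a n))) / (2 * \<epsilon>))"
  define H where "H = (\<lambda>\<delta>. (slope_volume \<delta> - slope_volume (- \<delta>)) / (2 * \<delta>))"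
  \<comment> \<open>\<open>lo\<close> is the factor of \<open>level_set_near\<close> with the smallest admissible \<open>\<theta>\<close>, and \<open>hi\<close> is the factor \<open>\<kappa>\<close> of \<open>near_level_set\<close>.\<close>
  define lo where "lo = (\<lambda>\<epsilon>. (1 - kmax\<^sup>2 / kmin * \<epsilon>)\<^sup>2)"
  define hi where "hi = (\<lambda>\<epsilon>. 1 + (kmax + kmax\<^sup>2 / kmin) * \<epsilon>)"
  have H: "(H \<longlongrightarrow> real n * slope_moment 1) (at_right 0)"
    unfolding H_def by (rule slope_volume_quotient)
  have small: "\<forall>\<^sub>F \<epsilon> in at_right 0. f \<epsilon> < b" if "(f \<longlongrightarrow> l) (at_right 0)" "l < b" for f :: "real \<Rightarrow> real" and l b
    using that by (rule order_tendstoD)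
  have lim: "(lo \<longlongrightarrow> (1 - kmax\<^sup>2 / kmin * 0)\<^sup>2) (at_right 0)" "(hi \<longlongrightarrow> 1 + (kmax + kmax\<^sup>2 / kmin) * 0) (at_right 0)"
    unfolding lo_def hi_def by (intro tendsto_intros)+
  have small1: "\<forall>\<^sub>F \<epsilon> in at_right 0. kmax\<^sup>2 / kmin * \<epsilon> < 1"
    by (rule small[where l="kmax\<^sup>2 / kmin * 0"]) (intro tendsto_intros, simp)
  have small2: "\<forall>\<^sub>F \<epsilon> in at_right 0. kmax * \<epsilon> < 1 / 2"
    by (rule small[where l="kmax * 0"]) (intro tendsto_intros, simp)
  have small3: "\<forall>\<^sub>F \<epsilon> in at_right 0. hi \<epsilon> * \<epsilon> * kmax < 1"
    by (rule small[where l="(1 + (kmax + kmax\<^sup>2 / kmin) * 0) * 0 * kmax"]) (intro tendsto_intros lim, simp)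
  have pos: "\<forall>\<^sub>F \<epsilon> in at_right 0. (0::real) < \<epsilon>" by (rule eventually_at_right_less)
  have sandwich: "\<forall>\<^sub>F \<epsilon> in at_right 0. H (lo \<epsilon> * \<epsilon>) * lo \<epsilon> \<le> T \<epsilon> \<and> T \<epsilon> \<le> H (hi \<epsilon> * \<epsilon>) * hi \<epsilon>
      \<and> 0 < lo \<epsilon> * \<epsilon> \<and> 0 < hi \<epsilon> * \<epsilon>"
    using small1 small2 small3 pos
  proof eventually_elim
    case (elim \<epsilon>)
    have K: "kmax\<^sup>2 / kmin > 0" using kmax_pos kmin_pos by simp
    define \<theta> where "\<theta> = kmax\<^sup>2 / kmin * \<epsilon>"
    have \<theta>: "0 < \<theta>" "\<theta> < 1" unfolding \<theta>_def using mult_pos_pos[OF K elim(4)] elim(1) by auto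
    have lo: "0 < lo \<epsilon>" "lo \<epsilon> \<le> 1" using \<theta> unfolding lo_def \<theta>_def[symmetric] by (auto simp: power_le_one)
    have hi: "1 \<le> hi \<epsilon>" unfolding hi_def using K kmax_pos elim by simp
    have d: "0 \<le> lo \<epsilon> * \<epsilon>" "lo \<epsilon> * \<epsilon> * kmax \<le> 1" "0 \<le> hi \<epsilon> * \<epsilon>" "hi \<epsilon> * \<epsilon> * kmax \<le> 1"
    proof -
      have "lo \<epsilon> * (\<epsilon> * kmax) \<le> 1 * (\<epsilon> * kmax)" using lo elim kmax_pos by (intro mult_right_mono) auto
      then show "lo \<epsilon> * \<epsilon> * kmax \<le> 1" using elim(2) by (simp only: mult.assoc mult.commute[of \<epsilon>] mult_1)
    qed (use lo hi elim in auto)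
    let ?T = "tube n \<epsilon> (boundary n (ellipsoid a n))"
    have T: "?T = {x \<in> Rn n. \<exists>y\<in>Rn n. ell_norm y = 1 \<and> dist_Rn n x y < \<epsilon>}"
      by (auto simp: tube_def boundary_ellipsoid)
    have sub1: "shell (lo \<epsilon> * \<epsilon>) \<subseteq> ?T"
    proof
      fix x assume x: "x \<in> shell (lo \<epsilon> * \<epsilon>)"
      have "kmax\<^sup>2 * \<epsilon> \<le> kmin * \<theta>" using kmin_pos by (simp add: \<theta>_def)
      then have "\<exists>y\<in>Rn n. ell_norm y = 1 \<and> dist_Rn n x y < \<epsilon>"
        using x elim \<theta> by (intro level_set_near[of \<theta>]) (auto simp: shell_def lo_def \<theta>_def)
      with x show "x \<in> ?T" unfolding T by (auto simp: shell_def)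
    qed
    have sub2: "?T \<subseteq> shell (hi \<epsilon> * \<epsilon>)"
      using near_level_set[of _ _ \<epsilon>] elim unfolding T shell_def hi_def by auto
    have "emeasure (lebesgue_Rn n) ?T \<le> emeasure (lebesgue_Rn n) (shell (hi \<epsilon> * \<epsilon>))"
      by (intro emeasure_mono sub2 shell d)
    also have "\<dots> < \<infinity>" by (intro shell d)
    finally have fin: "emeasure (lebesgue_Rn n) ?T < \<infinity>" .
    have "volume n (shell (lo \<epsilon> * \<epsilon>)) \<le> volume n ?T"
      unfolding volume_def using fin by (intro measure_mono_fmeasurable sub1 shell d fmeasurableI sets_tube)
    moreover have "volume n ?T \<le> volume n (shell (hi \<epsilon> * \<epsilon>))"
      unfolding volume_def by (intro measure_mono_fmeasurable sub2 shell d fmeasurableI sets_tube)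
    ultimately have "volume n (shell (lo \<epsilon> * \<epsilon>)) / (2 * \<epsilon>) \<le> T \<epsilon>" "T \<epsilon> \<le> volume n (shell (hi \<epsilon> * \<epsilon>)) / (2 * \<epsilon>)"
      unfolding T_def using elim by (auto intro!: divide_right_mono)
    moreover have "volume n (shell (lo \<epsilon> * \<epsilon>)) / (2 * \<epsilon>) = H (lo \<epsilon> * \<epsilon>) * lo \<epsilon>"
      unfolding shell(3)[OF d(1,2)] H_def using lo by simp
    moreover have "volume n (shell (hi \<epsilon> * \<epsilon>)) / (2 * \<epsilon>) = H (hi \<epsilon> * \<epsilon>) * hi \<epsilon>"
      unfolding shell(3)[OF d(3,4)] H_def using hi by simp
    ultimately show ?case using lo hi elim by simp
  qed
  have lim0: "filterlim (\<lambda>\<epsilon>. lo \<epsilon> * \<epsilon>) (at_right 0) (at_right 0)" "filterlim (\<lambda>\<epsilon>. hi \<epsilon> * \<epsilon>) (at_right 0) (at_right 0)"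
  proof -
    have "((\<lambda>\<epsilon>. lo \<epsilon> * \<epsilon>) \<longlongrightarrow> (1 - kmax\<^sup>2 / kmin * 0)\<^sup>2 * 0) (at_right 0)"
      "((\<lambda>\<epsilon>. hi \<epsilon> * \<epsilon>) \<longlongrightarrow> (1 + (kmax + kmax\<^sup>2 / kmin) * 0) * 0) (at_right 0)"
      by (intro tendsto_intros lim)+
    then show "filterlim (\<lambda>\<epsilon>. lo \<epsilon> * \<epsilon>) (at_right 0) (at_right 0)" "filterlim (\<lambda>\<epsilon>. hi \<epsilon> * \<epsilon>) (at_right 0) (at_right 0)"
      using sandwich by (auto simp: filterlim_at elim!: eventually_mono)
  qed
  have "(T \<longlongrightarrow> real n * slope_moment 1) (at_right 0)"
  proof (rule tendsto_sandwich)
    show "((\<lambda>\<epsilon>. H (lo \<epsilon> * \<epsilon>) * lo \<epsilon>) \<longlongrightarrow> real n * slope_moment 1) (at_right 0)"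
      using tendsto_mult[OF filterlim_compose[OF H lim0(1)] lim(1)] by simp
    show "((\<lambda>\<epsilon>. H (hi \<epsilon> * \<epsilon>) * hi \<epsilon>) \<longlongrightarrow> real n * slope_moment 1) (at_right 0)"
      using tendsto_mult[OF filterlim_compose[OF H lim0(2)] lim(2)] by simp
  qed (use sandwich in \<open>auto elim!: eventually_mono\<close>)
  then show ?thesis unfolding surface_area_def T_def
    by (intro tendsto_Lim) simp_all
qed

text \<open>
  The ratio is \<open>n\<close> times the mean of the slope over the ellipsoid. As the slope is constant along
  rays, the uniform distribution may be replaced by the Gaussian one, under which the coordinates
  are independent.
\<close>

theorem surface_volume_ratio_ellipsoid:
  "surface_volume_ratio n (ellipsoid a n) = real n * (\<integral>x. slope x * gauss_weight x \<partial>lebesgue_Rn n)"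
proof -
  have "(\<integral>x. slope x * gauss_weight x \<partial>lebesgue_Rn n) =
        (\<integral>x. slope x * indicator (ellipsoid a n) x \<partial>lebesgue_Rn n) / volume n (ellipsoid a n)"
    by (intro integral_homogeneous_gauss measurable_slope slope_nonneg slope_dilate)
  then show ?thesis
    unfolding surface_volume_ratio_def surface_area_ellipsoid by (simp add: slope_moment_def)
qed

end

section \<open>Concentration of the slope\<close>

text \<open>
  A bound by mean square deviations for the square root of a quotient of two quantities close to \<open>1\<close>.
  For \<open>T \<ge> 1/2\<close> the left-hand side is at most \<open>2 * \<bar>U - T\<bar>\<close>, which is split by the arithmetic-geometric
  mean inequality with parameter \<open>\<eta>\<close>. For \<open>T < 1/2\<close> it is bounded by a constant, while
  \<open>4 * (T - 1)^2 \<ge> 1\<close>. With \<open>U / T = 0\<close> for \<open>T = 0\<close>, no point has to be excluded.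
\<close>

lemma abs_sqrt_quotient_minus_one_le:
  fixes U T K \<eta> :: real
  assumes U: "0 \<le> U" "U \<le> K * T" and T: "0 \<le> T" and K: "0 \<le> K" and \<eta>: "0 < \<eta>"
  shows "\<bar>sqrt (U / T) - 1\<bar> \<le> \<eta> + 2 / \<eta> * ((U - 1)\<^sup>2 + (T - 1)\<^sup>2) + 4 * (1 + sqrt K) * (T - 1)\<^sup>2"
proof (cases "T < 1 / 2")
  case True
  have "U / T \<le> K" using U T K by (cases "T = 0") (auto simp: field_simps)
  then have "sqrt (U / T) \<le> sqrt K" by simp
  moreover have "sqrt (U / T) \<ge> 0" using U T by simp
  ultimately have *: "\<bar>sqrt (U / T) - 1\<bar> \<le> 1 + sqrt K" using real_sqrt_ge_zero[OF K] by linarith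
  have "(1 / 2)\<^sup>2 \<le> (1 - T)\<^sup>2" using True by (intro power_mono) auto
  then have "1 \<le> 4 * (T - 1)\<^sup>2" by (simp add: power2_commute[of T] power_one_over)
  then have "(1 + sqrt K) * 1 \<le> (1 + sqrt K) * (4 * (T - 1)\<^sup>2)" using K by (intro mult_left_mono) auto
  moreover have "0 \<le> \<eta> + 2 / \<eta> * ((U - 1)\<^sup>2 + (T - 1)\<^sup>2)" using \<eta> by (intro add_nonneg_nonneg mult_nonneg_nonneg) auto
  moreover have "(1 + sqrt K) * (4 * (T - 1)\<^sup>2) = 4 * (1 + sqrt K) * (T - 1)\<^sup>2" by simp
  ultimately show ?thesis
    using order_trans[OF *, of "4 * (1 + sqrt K) * (T - 1)\<^sup>2"] by (metis add_increasing mult.right_neutral)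
next
  case False
  define Y where "Y = U / T"
  have Y: "Y \<ge> 0" using U T by (simp add: Y_def)
  have "\<bar>sqrt Y - 1\<bar> * 1 \<le> \<bar>sqrt Y - 1\<bar> * (sqrt Y + 1)" using Y by (intro mult_left_mono) auto
  also have "\<dots> = \<bar>(sqrt Y - 1) * (sqrt Y + 1)\<bar>" using Y by (simp add: abs_mult)
  also have "(sqrt Y - 1) * (sqrt Y + 1) = Y - 1" using Y by (simp add: algebra_simps)
  also have "\<bar>Y - 1\<bar> = \<bar>U - T\<bar> / T" using False by (simp add: Y_def field_simps)
  also have "\<dots> \<le> \<bar>U - T\<bar> / (1 / 2)" using False by (intro divide_left_mono) auto
  finally have 1: "\<bar>sqrt Y - 1\<bar> \<le> 2 * \<bar>U - T\<bar>" by simp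
  have square: "(\<eta> - z)\<^sup>2 / \<eta> = \<eta> - 2 * z + z\<^sup>2 / \<eta>" for z
    using \<eta> by (simp add: field_simps power2_eq_square)
  have "0 \<le> (\<eta> - \<bar>U - T\<bar>)\<^sup>2 / \<eta>" using \<eta> by simp
  also have "\<dots> = \<eta> - 2 * \<bar>U - T\<bar> + (U - T)\<^sup>2 / \<eta>"
    using square[of "\<bar>U - T\<bar>"] by simp
  finally have 2: "2 * \<bar>U - T\<bar> \<le> \<eta> + (U - T)\<^sup>2 / \<eta>" by simp
  have "0 \<le> ((U - 1) + (T - 1))\<^sup>2" by simp
  then have "(U - T)\<^sup>2 \<le> 2 * ((U - 1)\<^sup>2 + (T - 1)\<^sup>2)"
    by (simp add: power2_eq_square algebra_simps)
  then have "(U - T)\<^sup>2 / \<eta> \<le> 2 / \<eta> * ((U - 1)\<^sup>2 + (T - 1)\<^sup>2)" using \<eta> by (simp add: divide_right_mono)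
  moreover have "0 \<le> 4 * (1 + sqrt K) * (T - 1)\<^sup>2" using K by simp
  ultimately show ?thesis using 1 2 unfolding Y_def by linarith
qed

context semiaxes
begin

definition dev :: "nat \<Rightarrow> real \<Rightarrow> real" where
  "dev i t = (t / a i)\<^sup>2 - 1"

text \<open>
  With \<open>Z\<close> standard normal, these are the moments of \<open>Z^2 - 1\<close>: mean \<open>0\<close> and, as the fourth moment of \<open>Z\<close>
  is \<open>3\<close>, variance \<open>3 - 2 + 1 = 2\<close>.
\<close>

lemma has_bochner_integral_dev_power:
  assumes i: "i \<in> {1..n}"
  shows "has_bochner_integral lborel (\<lambda>t. dev i t ^ 0 * normal_density 0 (a i) t) 1"
    and "has_bochner_integral lborel (\<lambda>t. dev i t ^ 1 * normal_density 0 (a i) t) 0"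
    and "has_bochner_integral lborel (\<lambda>t. dev i t ^ 2 * normal_density 0 (a i) t) 2"
proof -
  have m: "has_bochner_integral lborel (\<lambda>t. normal_density 0 (a i) t * t ^ (2 * k))
      (fact (2 * k) / ((2 / (a i)\<^sup>2) ^ k * fact k))" for k
    using normal_moment_even[OF pos[OF i], of 0 k] by simp
  have a0: "a i \<noteq> 0" using pos[OF i] by simp
  note h0 = m[of 0]
  note h1 = has_bochner_integral_mult_left[OF m[of 1], of "1 / (a i)\<^sup>2"]
  note h2 = has_bochner_integral_mult_left[OF m[of 2], of "1 / (a i) ^ 4"]
  show "has_bochner_integral lborel (\<lambda>t. dev i t ^ 0 * normal_density 0 (a i) t) 1"
    using h0 by simp
  have h1': "has_bochner_integral lborel (\<lambda>t. normal_density 0 (a i) t * t ^ (2 * 1) * (1 / (a i)\<^sup>2)) 1"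
    using h1 a0 by (simp add: fact_numeral)
  have h2': "has_bochner_integral lborel (\<lambda>t. normal_density 0 (a i) t * t ^ (2 * 2) * (1 / (a i) ^ 4)) 3"
    using h2 a0 by (simp add: fact_numeral power_divide flip: power_mult)
  have h0': "has_bochner_integral lborel (\<lambda>t. normal_density 0 (a i) t * t ^ (2 * 0)) 1"
    using h0 by simp
  show "has_bochner_integral lborel (\<lambda>t. dev i t ^ 1 * normal_density 0 (a i) t) 0"
    using has_bochner_integral_diff[OF h1' h0']
    by (rule has_bochner_integral_cong[THEN iffD1, rotated -1]) (auto simp: dev_def power_divide power2_eq_square algebra_simps)
  show "has_bochner_integral lborel (\<lambda>t. dev i t ^ 2 * normal_density 0 (a i) t) 2"
    using has_bochner_integral_add[OF has_bochner_integral_diff[OF h2' has_bochner_integral_mult_right[OF h1', of 2]] h0']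
    by (rule has_bochner_integral_cong[THEN iffD1, rotated -1])
       (auto simp: dev_def power_divide power2_eq_square power4_eq_xxxx algebra_simps)
qed

text \<open>
  Independent coordinates are uncorrelated. Writing the two factors as the product of all
  \<open>dev k (x k) ^ e k\<close>, where \<open>e k\<close> counts how often \<open>k\<close> occurs among \<open>i\<close> and \<open>j\<close>, covers both the
  diagonal and the off-diagonal case by one application of Fubini's theorem.
\<close>

lemma has_bochner_integral_dev_dev:
  assumes i: "i \<in> {1..n}" and j: "j \<in> {1..n}"
  shows "has_bochner_integral (lebesgue_Rn n) (\<lambda>x. dev i (x i) * dev j (x j) * gauss_weight x) (if i = j then 2 else 0)"
proof -
  define e where "e = (\<lambda>k. of_bool (k = i) + of_bool (k = j) :: nat)"
  define c where "c = (\<lambda>m::nat. if m = 0 then 1 else if m = 1 then 0 else 2 :: real)"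
  let ?f = "\<lambda>k t. dev k t ^ e k * normal_density 0 (a k) t"
  have f: "has_bochner_integral lborel (?f k) (c (e k))" if "k \<in> {1..n}" for k
    using has_bochner_integral_dev_power[OF that] by (auto simp: e_def c_def numeral_2_eq_2)
  have int: "integrable (lebesgue_Rn n) (\<lambda>x. \<Prod>k=1..n. ?f k (x k))"
    by (intro lborel_product.product_integrable_prod) (use f in \<open>auto simp: has_bochner_integral_iff\<close>)
  have "(\<integral>x. (\<Prod>k=1..n. ?f k (x k)) \<partial>lebesgue_Rn n) = (\<Prod>k=1..n. integral\<^sup>L lborel (?f k))"
    by (intro lborel_product.product_integral_prod) (use f in \<open>auto simp: has_bochner_integral_iff\<close>)
  also have "\<dots> = (\<Prod>k=1..n. c (e k))"
    by (intro prod.cong refl has_bochner_integral_integral_eq f)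
  also have "\<dots> = (if i = j then 2 else 0)"
  proof (cases "i = j")
    case True
    then have "(\<Prod>k=1..n. c (e k)) = (\<Prod>k=1..n. if k = i then 2 else 1)"
      by (intro prod.cong) (auto simp: c_def e_def)
    with i True show ?thesis by simp
  next
    case False
    then have "c (e i) = 0" by (simp add: c_def e_def)
    with i False show ?thesis by (auto intro!: prod_zero)
  qed
  finally have hb: "has_bochner_integral (lebesgue_Rn n) (\<lambda>x. \<Prod>k=1..n. ?f k (x k)) (if i = j then 2 else 0)"
    using int by (simp add: has_bochner_integral_iff)
  have single: "(\<Prod>k=1..n. dev k (x k) ^ of_bool (k = l)) = dev l (x l)" if "l \<in> {1..n}" for l x
  proof -
    have "(\<Prod>k=1..n. dev k (x k) ^ of_bool (k = l)) = (\<Prod>k=1..n. if k = l then dev k (x k) else 1)"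
      by (intro prod.cong) auto
    with that show ?thesis by simp
  qed
  have "(\<Prod>k=1..n. ?f k (x k)) = dev i (x i) * dev j (x j) * gauss_weight x" for x
    unfolding e_def power_add prod.distrib single[OF i] single[OF j] gauss_weight_def ..
  with hb show ?thesis by simp
qed

lemma has_bochner_integral_sum_dev_power2:
  "has_bochner_integral (lebesgue_Rn n) (\<lambda>x. (\<Sum>i=1..n. b i * dev i (x i))\<^sup>2 * gauss_weight x) (2 * (\<Sum>i=1..n. (b i)\<^sup>2))"
proof -
  have "has_bochner_integral (lebesgue_Rn n)
      (\<lambda>x. \<Sum>i=1..n. \<Sum>j=1..n. (b i * b j) * (dev i (x i) * dev j (x j) * gauss_weight x))
      (\<Sum>i=1..n. \<Sum>j=1..n. (b i * b j) * (if i = j then 2 else 0))"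
    by (intro has_bochner_integral_sum has_bochner_integral_mult_right has_bochner_integral_dev_dev)
  also have "(\<lambda>x. \<Sum>i=1..n. \<Sum>j=1..n. (b i * b j) * (dev i (x i) * dev j (x j) * gauss_weight x)) =
      (\<lambda>x. (\<Sum>i=1..n. b i * dev i (x i))\<^sup>2 * gauss_weight x)"
    unfolding power2_eq_square sum_product unfolding sum_distrib_right
    by (intro ext sum.cong refl) (simp add: mult_ac)
  also have "(\<Sum>i=1..n. \<Sum>j=1..n. (b i * b j) * (if i = j then 2 else 0)) = 2 * (\<Sum>i=1..n. (b i)\<^sup>2)"
    unfolding sum_distrib_left
    by (intro sum.cong refl) (simp add: power2_eq_square if_distrib[where f = "\<lambda>z. _ * z"] sum.delta cong: if_cong)
  finally show ?thesis .
qed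

lemma has_bochner_integral_gauss_weight: "has_bochner_integral (lebesgue_Rn n) gauss_weight 1"
  using nn_integral_gauss_weight gauss_weight_nonneg measurable_gauss_weight
  by (intro has_bochner_integral_nn_integral) auto

text \<open>
  The squared slope, divided by the mean of the numbers \<open>1 / (a i)^2\<close>, is a quotient \<open>U / T\<close> of weighted
  means of the variables \<open>(x i / a i)^2\<close>, whose expectation is \<open>1\<close>: \<open>U\<close> has the weights \<open>b i\<close>
  proportional to \<open>1 / (a i)^2\<close> and \<open>T\<close> has equal weights. Under the comparability assumption
  \<open>b i \<le> K / n\<close>, so that \<open>U\<close> and \<open>T\<close> have variances at most \<open>2 * K / n\<close> and \<open>2 / n\<close>.
\<close>

lemma expected_slope:
  fixes K \<eta> :: real
  assumes K: "\<And>i j. i \<in> {1..n} \<Longrightarrow> j \<in> {1..n} \<Longrightarrow> 1 / (a i)\<^sup>2 \<le> K * (1 / (a j)\<^sup>2)" and \<eta>: "\<eta> > 0"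
  shows "\<bar>(\<integral>x. slope x * gauss_weight x \<partial>lebesgue_Rn n) / sqrt ((\<Sum>i=1..n. 1 / (a i)\<^sup>2) / real n) - 1\<bar>
     \<le> \<eta> + 2 / \<eta> * (2 * K / real n + 2 / real n) + 4 * (1 + sqrt K) * (2 / real n)"
proof -
  define w where "w = (\<lambda>i. 1 / (a i)\<^sup>2)"
  define S where "S = (\<Sum>i=1..n. w i)"
  define b where "b = (\<lambda>i. w i / S)"
  define U where "U = (\<lambda>x. \<Sum>i=1..n. b i * (x i / a i)\<^sup>2)"
  define T where "T = (\<lambda>x. \<Sum>i=1..n. 1 / real n * (x i / a i)\<^sup>2)"
  have n0: "real n > 0" using n_pos by simp
  have w: "w i > 0" if "i \<in> {1..n}" for i using pos[OF that] by (simp add: w_def)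
  have S: "S > 0" unfolding S_def using w n_pos by (intro sum_pos) auto
  have one: "1 \<in> {1..n}" using n_pos by simp
  have K0: "K \<ge> 0"
  proof -
    have "1 * w 1 \<le> K * w 1" using K[OF one one] by (simp add: w_def)
    then have "1 \<le> K" using w[OF one] by (rule mult_right_le_imp_le)
    then show ?thesis by simp
  qed
  have b0: "b i \<ge> 0" if "i \<in> {1..n}" for i using w[OF that] S by (simp add: b_def)
  have bsum: "(\<Sum>i=1..n. b i) = 1" using S by (simp add: b_def S_def flip: sum_divide_distrib)
  have bK: "b i \<le> K * (1 / real n)" if i: "i \<in> {1..n}" for i
  proof -
    have "(\<Sum>j=1..n. w i) \<le> (\<Sum>j=1..n. K * w j)"
      using K[OF i] unfolding w_def by (intro sum_mono) auto
    then have "real n * w i \<le> K * S" by (simp add: S_def sum_distrib_left)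
    then show ?thesis using S n0 by (simp add: b_def field_simps)
  qed
  have U1: "U x - 1 = (\<Sum>i=1..n. b i * dev i (x i))" for x
    unfolding U_def dev_def by (simp add: algebra_simps sum_subtractf bsum[simplified])
  have T1: "T x - 1 = (\<Sum>i=1..n. 1 / real n * dev i (x i))" for x
    unfolding T_def dev_def using n0 by (simp add: algebra_simps sum_subtractf diff_divide_distrib)
  have VU: "has_bochner_integral (lebesgue_Rn n) (\<lambda>x. (U x - 1)\<^sup>2 * gauss_weight x) (2 * (\<Sum>i=1..n. (b i)\<^sup>2))"
    unfolding U1 by (rule has_bochner_integral_sum_dev_power2)
  have "2 * (\<Sum>i=1..n. (1 / real n)\<^sup>2) = 2 / real n"
    using n0 by (simp add: power2_eq_square)
  then have VT: "has_bochner_integral (lebesgue_Rn n) (\<lambda>x. (T x - 1)\<^sup>2 * gauss_weight x) (2 / real n)"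
    unfolding T1 using has_bochner_integral_sum_dev_power2[of "\<lambda>_. 1 / real n"] by simp
  have "(\<Sum>i=1..n. (b i)\<^sup>2) \<le> (\<Sum>i=1..n. b i * (K * (1 / real n)))"
    unfolding power2_eq_square using b0 bK by (intro sum_mono mult_left_mono) auto
  also have "\<dots> = K / real n" by (simp only: sum_distrib_right[symmetric] bsum) simp
  finally have bb: "2 * (\<Sum>i=1..n. (b i)\<^sup>2) \<le> 2 * K / real n" by simp
  have slope_eq: "slope x = sqrt (S / real n) * sqrt (U x / T x)" for x
  proof -
    have "(ell_normal x)\<^sup>2 = S * U x"
      unfolding ell_normal_def power2_L2_set U_def sum_distrib_left
      using S by (intro sum.cong refl) (simp add: b_def w_def power_divide)
    then have 1: "ell_normal x = sqrt (S * U x)" by (simp add: real_sqrt_unique)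
    have "(ell_norm x)\<^sup>2 = real n * T x"
      unfolding ell_norm_def power2_L2_set T_def sum_distrib_left
      using n0 by (intro sum.cong refl) simp
    then have 2: "ell_norm x = sqrt (real n * T x)" by (simp add: real_sqrt_unique)
    show ?thesis unfolding slope_def 1 2 by (simp add: real_sqrt_mult real_sqrt_divide)
  qed
  have T0: "T x \<ge> 0" and U0: "U x \<ge> 0" and UT: "U x \<le> K * T x" for x
  proof -
    show "T x \<ge> 0" unfolding T_def by (intro sum_nonneg) simp
    show "U x \<ge> 0" unfolding U_def using b0 by (intro sum_nonneg) simp
    show "U x \<le> K * T x" unfolding U_def T_def sum_distrib_left mult.assoc[symmetric]
      using bK by (intro sum_mono mult_right_mono) auto
  qed
  let ?g = "\<lambda>x. (sqrt (U x / T x) - 1) * gauss_weight x"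
  let ?B = "\<lambda>x. \<eta> * gauss_weight x + 2 / \<eta> * ((U x - 1)\<^sup>2 * gauss_weight x + (T x - 1)\<^sup>2 * gauss_weight x)
      + 4 * (1 + sqrt K) * ((T x - 1)\<^sup>2 * gauss_weight x)"
  have B: "has_bochner_integral (lebesgue_Rn n) ?B
     (\<eta> * 1 + 2 / \<eta> * (2 * (\<Sum>i=1..n. (b i)\<^sup>2) + 2 / real n) + 4 * (1 + sqrt K) * (2 / real n))"
    by (intro has_bochner_integral_add has_bochner_integral_mult_right VU VT has_bochner_integral_gauss_weight)
  then have Bi: "integrable (lebesgue_Rn n) ?B" by (simp only: has_bochner_integral_iff)
  have gB: "\<bar>?g x\<bar> \<le> ?B x" for x
  proof -
    have "\<bar>?g x\<bar> = \<bar>sqrt (U x / T x) - 1\<bar> * gauss_weight x"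
      using gauss_weight_nonneg[of x] by (simp add: abs_mult)
    also have "\<dots> \<le> (\<eta> + 2 / \<eta> * ((U x - 1)\<^sup>2 + (T x - 1)\<^sup>2) + 4 * (1 + sqrt K) * (T x - 1)\<^sup>2) * gauss_weight x"
      using abs_sqrt_quotient_minus_one_le[OF U0 UT T0 K0 \<eta>] gauss_weight_nonneg by (intro mult_right_mono)
    finally show ?thesis by (simp only: distrib_right distrib_left mult.assoc)
  qed
  have g_eq: "?g x = slope x * gauss_weight x / sqrt (S / real n) - gauss_weight x" for x
    using S n0 unfolding slope_eq by (simp add: algebra_simps)
  have gm: "?g \<in> borel_measurable (lebesgue_Rn n)"
    unfolding g_eq by (intro borel_measurable_diff borel_measurable_divide borel_measurable_times
        measurable_slope measurable_gauss_weight borel_measurable_const)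
  have gi: "integrable (lebesgue_Rn n) ?g"
    unfolding real_norm_def
    by (intro Bochner_Integration.integrable_bound[OF Bi gm] AE_I2) (simp only: real_norm_def order_trans[OF gB abs_ge_self])
  have Wi: "integrable (lebesgue_Rn n) gauss_weight" "(\<integral>x. gauss_weight x \<partial>lebesgue_Rn n) = 1"
    using has_bochner_integral_gauss_weight by (auto simp: has_bochner_integral_iff)
  have si: "integrable (lebesgue_Rn n) (\<lambda>x. slope x * gauss_weight x / sqrt (S / real n))"
    using Bochner_Integration.integrable_add[OF gi Wi(1)] unfolding g_eq by simp
  have "(\<integral>x. ?g x \<partial>lebesgue_Rn n) = (\<integral>x. slope x * gauss_weight x \<partial>lebesgue_Rn n) / sqrt (S / real n) - 1"
    unfolding g_eq Bochner_Integration.integral_diff[OF si Wi(1)] Wi(2) by simp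
  then have "\<bar>(\<integral>x. slope x * gauss_weight x \<partial>lebesgue_Rn n) / sqrt (S / real n) - 1\<bar> = \<bar>\<integral>x. ?g x \<partial>lebesgue_Rn n\<bar>" by simp
  also have "\<dots> \<le> (\<integral>x. \<bar>?g x\<bar> \<partial>lebesgue_Rn n)" by (rule integral_abs_bound)
  also have "\<dots> \<le> (\<integral>x. ?B x \<partial>lebesgue_Rn n)"
    by (intro Bochner_Integration.integral_mono integrable_abs gi Bi gB)
  also have "\<dots> = \<eta> * 1 + 2 / \<eta> * (2 * (\<Sum>i=1..n. (b i)\<^sup>2) + 2 / real n) + 4 * (1 + sqrt K) * (2 / real n)"
    using B by (rule has_bochner_integral_integral_eq)
  also have "\<dots> \<le> \<eta> + 2 / \<eta> * (2 * K / real n + 2 / real n) + 4 * (1 + sqrt K) * (2 / real n)"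
    using bb \<eta> K0 by (intro add_mono mult_left_mono) auto
  finally show ?thesis unfolding S_def w_def .
qed

end

section \<open>The quotient of Gamma values\<close>

text \<open>
  Logarithmic convexity at the midpoint of \<open>x\<close> and \<open>x + 1\<close>.
\<close>

lemma Gamma_half_step_le:
  fixes x :: real
  assumes "x > 0"
  shows "(Gamma (x + 1 / 2))\<^sup>2 \<le> Gamma x * Gamma (x + 1)"
proof -
  have "(ln \<circ> Gamma) ((1 - 1 / 2) *\<^sub>R x + (1 / 2) *\<^sub>R (x + 1)) \<le>
      (1 - 1 / 2) * (ln \<circ> Gamma) x + 1 / 2 * (ln \<circ> Gamma) (x + 1)"
    using assms by (intro convex_onD[OF log_convex_Gamma_real]) auto
  moreover have "(1 - 1 / 2) *\<^sub>R x + (1 / 2) *\<^sub>R (x + 1) = x + 1 / 2" by (simp add: field_simps)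
  ultimately have "2 * ln (Gamma (x + 1 / 2)) \<le> ln (Gamma x) + ln (Gamma (x + 1))" by simp
  moreover have "Gamma x > 0" "Gamma (x + 1) > 0" "Gamma (x + 1 / 2) > 0"
    using assms by (auto intro: Gamma_real_pos)
  ultimately have "ln ((Gamma (x + 1 / 2))\<^sup>2) \<le> ln (Gamma x * Gamma (x + 1))"
    by (simp add: ln_mult ln_realpow)
  with \<open>Gamma x > 0\<close> \<open>Gamma (x + 1) > 0\<close> \<open>Gamma (x + 1 / 2) > 0\<close> show ?thesis by simp
qed

text \<open>
  The two bounds are the preceding inequality at \<open>x\<close> and at \<open>x - 1/2\<close>, rewritten with the functional
  equation.
\<close>

lemma Gamma_half_step_bounds:
  fixes x :: real
  assumes x: "x > 1 / 2"
  shows "(Gamma (x + 1 / 2) / Gamma x)\<^sup>2 \<le> x" and "x - 1 / 2 \<le> (Gamma (x + 1 / 2) / Gamma x)\<^sup>2"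
proof -
  have G: "Gamma x > 0" "Gamma (x + 1 / 2) > 0" using x by (auto intro: Gamma_real_pos)
  have "Gamma (x + 1) = x * Gamma x" using x by (intro Gamma_plus1) (auto elim!: nonpos_Ints_cases)
  with Gamma_half_step_le[of x] x have "(Gamma (x + 1 / 2))\<^sup>2 \<le> x * (Gamma x)\<^sup>2"
    by (simp add: power2_eq_square mult_ac)
  with G show "(Gamma (x + 1 / 2) / Gamma x)\<^sup>2 \<le> x" by (simp add: power_divide divide_le_eq)
  have "Gamma (x - 1 / 2 + 1) = (x - 1 / 2) * Gamma (x - 1 / 2)"
    using x by (intro Gamma_plus1) (auto elim!: nonpos_Ints_cases)
  moreover have "x - 1 / 2 + 1 = x + 1 / 2" by simp
  ultimately have s: "Gamma (x + 1 / 2) = (x - 1 / 2) * Gamma (x - 1 / 2)" by (simp only:)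
  have "(Gamma x)\<^sup>2 \<le> Gamma (x - 1 / 2) * Gamma (x + 1 / 2)"
  proof -
    have "x - 1 / 2 + 1 / 2 = x" "x - 1 / 2 + 1 = x + 1 / 2" by simp_all
    with Gamma_half_step_le[of "x - 1 / 2"] x show ?thesis by (simp only:)
  qed
  then have "(x - 1 / 2) * (Gamma x)\<^sup>2 \<le> (x - 1 / 2) * (Gamma (x - 1 / 2) * Gamma (x + 1 / 2))"
    using x by (intro mult_left_mono) auto
  also have "\<dots> = (Gamma (x + 1 / 2))\<^sup>2" unfolding s by (simp add: power2_eq_square)
  finally show "x - 1 / 2 \<le> (Gamma (x + 1 / 2) / Gamma x)\<^sup>2" using G by (simp add: power_divide le_divide_eq)
qed

lemma Gamma_half_step_asymptotic:
  "(\<lambda>n. Gamma ((real n + 1) / 2) / Gamma (real n / 2) / sqrt (real n / 2)) \<longlonglongrightarrow> 1"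
proof -
  define r where "r = (\<lambda>n. Gamma ((real n + 1) / 2) / Gamma (real n / 2))"
  have ev: "\<forall>\<^sub>F n in sequentially. 1 - 1 / real n \<le> (r n)\<^sup>2 / (real n / 2) \<and> (r n)\<^sup>2 / (real n / 2) \<le> 1 \<and> r n \<ge> 0"
    using eventually_gt_at_top[of 1]
  proof eventually_elim
    case (elim n)
    have "real n / 2 + 1 / 2 = (real n + 1) / 2" by (simp add: add_divide_distrib)
    then have b: "(r n)\<^sup>2 \<le> real n / 2" "real n / 2 - 1 / 2 \<le> (r n)\<^sup>2"
      using Gamma_half_step_bounds[of "real n / 2"] elim
      unfolding r_def \<open>real n / 2 + 1 / 2 = (real n + 1) / 2\<close> by auto
    have "1 - 1 / real n = (real n / 2 - 1 / 2) / (real n / 2)"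
      using elim by (simp add: field_simps)
    also have "\<dots> \<le> (r n)\<^sup>2 / (real n / 2)"
      using b(2) by (intro divide_right_mono) auto
    finally have "1 - 1 / real n \<le> (r n)\<^sup>2 / (real n / 2)" .
    moreover have "(r n)\<^sup>2 / (real n / 2) \<le> 1"
      using b(1) elim by (simp add: field_simps)
    moreover have "r n \<ge> 0" unfolding r_def using elim by (auto intro!: divide_nonneg_pos Gamma_real_nonneg Gamma_real_pos)
    ultimately show ?case by blast
  qed
  have "(\<lambda>n. (r n)\<^sup>2 / (real n / 2)) \<longlonglongrightarrow> 1"
  proof (rule tendsto_sandwich)
    have "(\<lambda>n. 1 - 1 / real n) \<longlonglongrightarrow> 1 - 0" by (intro tendsto_diff tendsto_const lim_1_over_n)
    then show "(\<lambda>n. 1 - 1 / real n) \<longlonglongrightarrow> 1" by simp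
    show "(\<lambda>n. 1) \<longlonglongrightarrow> (1::real)" by (rule tendsto_const)
    show "\<forall>\<^sub>F n in sequentially. 1 - 1 / real n \<le> (r n)\<^sup>2 / (real n / 2)"
      using ev by eventually_elim blast
    show "\<forall>\<^sub>F n in sequentially. (r n)\<^sup>2 / (real n / 2) \<le> 1"
      using ev by eventually_elim blast
  qed
  then have "(\<lambda>n. sqrt ((r n)\<^sup>2 / (real n / 2))) \<longlonglongrightarrow> sqrt 1" by (rule tendsto_real_sqrt)
  moreover have "\<forall>\<^sub>F n in sequentially. sqrt ((r n)\<^sup>2 / (real n / 2)) = r n / sqrt (real n / 2)"
    using ev by eventually_elim (simp only: real_sqrt_divide real_sqrt_abs abs_of_nonneg)
  ultimately show ?thesis unfolding r_def by (simp add: filterlim_cong)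
qed

section \<open>The asymptotic ratio of surface area to volume\<close>

theorem corollary12:
  fixes a :: "nat \<Rightarrow> real" and c1 c2 :: real
  assumes pos: "\<And>i. i \<ge> 1 \<Longrightarrow> a i > 0"
    and c1_pos: "0 < c1"
    and ratio_lower: "\<And>i j. i \<ge> 1 \<Longrightarrow> j \<ge> 1 \<Longrightarrow> c1 \<le> a i / a j"
    and ratio_upper: "\<And>i j. i \<ge> 1 \<Longrightarrow> j \<ge> 1 \<Longrightarrow> a i / a j \<le> c2"
  shows "(\<lambda>n. Gamma ((real n + 1) / 2) / Gamma (real n / 2) *
              (surface_volume_ratio n (ellipsoid a n) /
               (real n * sqrt (1 / 2 * (\<Sum>i=1..n. 1 / (a i)\<^sup>2))))) \<longlonglongrightarrow> 1"
proof -
  define S where "S = (\<lambda>n. \<Sum>i=1..n. 1 / (a i)\<^sup>2)"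
  define J where "J = (\<lambda>n. surface_volume_ratio n (ellipsoid a n) / real n)"
  define G where "G = (\<lambda>n. Gamma ((real n + 1) / 2) / Gamma (real n / 2))"
  have ratio: "1 / (a i)\<^sup>2 \<le> c2\<^sup>2 * (1 / (a j)\<^sup>2)" if "i \<ge> 1" "j \<ge> 1" for i j
  proof -
    have "(a j / a i)\<^sup>2 \<le> c2\<^sup>2"
      using ratio_upper[of j i] pos[of i] pos[of j] that by (intro power_mono) auto
    then show ?thesis using pos[of i] pos[of j] that by (simp add: power_divide field_simps)
  qed
  define err where "err = (\<lambda>n. 1 / sqrt (real n) + 2 / (1 / sqrt (real n)) * (2 * c2\<^sup>2 / real n + 2 / real n)
      + 4 * (1 + sqrt (c2\<^sup>2)) * (2 / real n))"
  \<comment> \<open>\<open>err\<close> is the bound of \<open>expected_slope\<close> with \<open>\<eta> = 1 / sqrt n\<close>, which balances its first two terms.\<close>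
  have bound: "\<forall>\<^sub>F n in sequentially. norm (J n / sqrt (S n / real n) - 1) \<le> err n"
    using eventually_gt_at_top[of 0]
  proof eventually_elim
    case (elim n)
    interpret semiaxes n a by standard (use elim pos in auto)
    have "J n = (\<integral>x. slope x * gauss_weight x \<partial>lebesgue_Rn n)"
      unfolding J_def surface_volume_ratio_ellipsoid using elim by simp
    with expected_slope[of "c2\<^sup>2" "1 / sqrt (real n)"] ratio elim show ?case
      unfolding err_def S_def real_norm_def by simp
  qed
  have "err \<longlonglongrightarrow> 0" unfolding err_def by real_asymp
  then have "(\<lambda>n. J n / sqrt (S n / real n) - 1) \<longlonglongrightarrow> 0"
    using bound by (rule Lim_null_comparison[rotated])
  then have "(\<lambda>n. J n / sqrt (S n / real n)) \<longlonglongrightarrow> 1"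
    by (simp add: LIM_zero_iff)
  from tendsto_mult[OF Gamma_half_step_asymptotic this]
  have "(\<lambda>n. G n / sqrt (real n / 2) * (J n / sqrt (S n / real n))) \<longlonglongrightarrow> 1"
    by (simp add: G_def)
  moreover have "\<forall>\<^sub>F n in sequentially. G n / sqrt (real n / 2) * (J n / sqrt (S n / real n)) =
      G n * (surface_volume_ratio n (ellipsoid a n) / (real n * sqrt (1 / 2 * S n)))"
    using eventually_gt_at_top[of 0]
  proof eventually_elim
    case (elim n)
    have "sqrt (real n / 2) * sqrt (S n / real n) = sqrt (1 / 2 * S n)"
      using elim by (simp flip: real_sqrt_mult)
    then have "sqrt (1 / 2 * S n) = sqrt (real n / 2) * sqrt (S n / real n)" by (rule sym)
    then show ?case unfolding J_def by (simp only: times_divide_times_eq) (simp only: mult_ac times_divide_eq_right divide_divide_eq_left)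
  qed
  ultimately show ?thesis
    unfolding G_def S_def by (rule Lim_transform_eventually)
qed

end
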